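(* For each integer $k\ge 1$ there exists an (explicit) constant $\lambda_k>m(\gamma_k^1)$ such that any $(k,\lambda_k)$-admissible word $\theta$ containing (with the starred entry at position $0$) the string $$\theta_k^0=2_{2k}\,1_2\,2_{2k+2}\,1_2\,2_{2k}\,1_2\,2^*\,2_{2k}\,1_2\,2_{2k+2}\,1_2\,2_{2k}\,1$$ must extend as $$\theta=\dots 2_{2k}\,1_2\,2_{2k+2}\,1_2\,2_{2k}\,1_2\,2_{2k+1}\,1_2\,2_{2k+2}\,1_2\,2_{2k}\,1_2\,2^*\,2_{2k}\,1_2\,2_{2k+2}\,1_2\,2_{2k}\,1_2\,2_{2k+1}\,1_2\,2_{2k+2}\,1_2\,2_{2k}\dots,$$ and the neighbourhood of the position $-(6k+9)$ in $\theta$ is $\dots 2_{2k}\,1_2\,2_{2k+2}\,1_2\,2_{2k}\,1_2\,2^*\,2_{2k}\,1_2\,2_{2k+2}\,1_2\,2_{2k}\,1\dots$ (with the starred entry placed at position $-(6k+9)$). In particular, any $(k,\lambda_k)$-admissible word $\theta$ containing $\theta_k^0$ has the form $$\overline{2_{2k}\,1_2\,2_{2k+1}\,1_2\,2_{2k+2}\,1_2}\;2_{2k}\,1_2\,2^*\,2_{2k}\,1_2\,2_{2k+2}\,1_2\,2_{2k}\,1_2\,2_{2k+1}\,1_2\,2_{2k+2}\,1_2\,2_{2k}\dots,$$ where the overlined block is repeated infinitely often to the left.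
   Context: All words are over the alphabet $\{1,2\}$. Subscripts indicate repetition of a character (e.g. $1_2 2_4$ is $112222$), juxtaposition is concatenation, and an asterisk marks the entry in position $0$; writing $\theta=\dots u\dots$ means that $\theta$ contains the string $u$ with its starred entry at position $0$. For $\theta=(a_n)_{n\in\mathbb{Z}}\in\{1,2\}^{\mathbb{Z}}$ put $\lambda_i(\theta)=[a_i;a_{i+1},a_{i+2},\dots]+[0;a_{i-1},a_{i-2},\dots]$ and $m(\theta)=\sup_{i\in\mathbb{Z}}\lambda_i(\theta)$. For $k\ge1$ let $\underline{\omega}_k=2_{2k}\,1_2\,2_{2k+1}\,1_2\,2_{2k+2}\,1_2$, let $\theta(\underline{\omega}_k)$ be the bi-infinite periodic word obtained by repeating $\underline{\omega}_k$, and let $\gamma_k^1=\overline{\underline{\omega}_k}\,\underline{\omega}_k\,\underline{\omega}_k\,\overline{2}$ be the bi-infinite word consisting of infinitely many copies of $\underline{\omega}_k$ to the left, then two further copies of $\underline{\omega}_k$, then infinitely many $2$'s to the right. A word $\theta\in\{1,2\}^{\mathbb{Z}}$ is $(k,\lambda)$-admissible if $m(\theta(\underline{\omega}_k))<m(\theta)=\lambda_0(\theta)<\lambda$. *)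

theory Defs
  imports Complex_Main
begin

text \<open>Bi-infinite words are functions \<open>int \<Rightarrow> nat\<close>; words over the alphabet \<open>{1, 2}\<close> are those in
  \<open>words12\<close>. Finite strings are lists.\<close>

definition words12 :: "(int \<Rightarrow> nat) set" where
  "words12 = {\<theta>. range \<theta> \<subseteq> {1, 2}}"

abbreviation ones :: "nat \<Rightarrow> nat list" where
  "ones n \<equiv> replicate n 1"

abbreviation twos :: "nat \<Rightarrow> nat list" where
  "twos n \<equiv> replicate n 2"

text \<open>\<open>cfrac_conv a n\<close> is the finite continued fraction \<open>[a 0; a 1, \<dots>, a n]\<close>.\<close>

primrec cfrac_conv :: "(nat \<Rightarrow> nat) \<Rightarrow> nat \<Rightarrow> real" where
  "cfrac_conv a 0 = real (a 0)"
| "cfrac_conv a (Suc n) = real (a 0) + 1 / cfrac_conv (\<lambda>j. a (Suc j)) n"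

definition cfrac :: "(nat \<Rightarrow> nat) \<Rightarrow> real" where
  "cfrac a = lim (cfrac_conv a)"

text \<open>The summand \<open>[0; \<theta> (i - 1), \<theta> (i - 2), \<dots>]\<close> has leading entry \<open>0\<close>, hence the case
  distinction on \<open>j\<close>.\<close>

definition lambda :: "int \<Rightarrow> (int \<Rightarrow> nat) \<Rightarrow> real" where
  "lambda i \<theta> = cfrac (\<lambda>j. \<theta> (i + int j)) + cfrac (\<lambda>j. if j = 0 then 0 else \<theta> (i - int j))"

definition markov :: "(int \<Rightarrow> nat) \<Rightarrow> real" where
  "markov \<theta> = (SUP i. lambda i \<theta>)"

definition omega :: "nat \<Rightarrow> nat list" where
  "omega k = twos (2*k) @ ones 2 @ twos (2*k+1) @ ones 2 @ twos (2*k+2) @ ones 2"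

text \<open>\<open>biinfinite u v w\<close> is the word \<open>\<dots>uuu v www\<dots>\<close>, with \<open>v\<close> starting at position \<open>0\<close>;
  \<open>u\<close> and \<open>w\<close> must be nonempty.\<close>

definition biinfinite :: "nat list \<Rightarrow> nat list \<Rightarrow> nat list \<Rightarrow> int \<Rightarrow> nat" where
  "biinfinite u v w i =
     (if i < 0 then u ! nat (i mod int (length u))
      else if i < int (length v) then v ! nat i
      else w ! nat ((i - int (length v)) mod int (length w)))"

definition theta_omega :: "nat \<Rightarrow> int \<Rightarrow> nat" where
  "theta_omega k = biinfinite (omega k) [] (omega k)"

definition gamma1 :: "nat \<Rightarrow> int \<Rightarrow> nat" where
  "gamma1 k = biinfinite (omega k) (omega k @ omega k) [2]"

definition admissible :: "nat \<Rightarrow> real \<Rightarrow> (int \<Rightarrow> nat) \<Rightarrow> bool" where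
  "admissible k l \<theta> \<longleftrightarrow>
     \<theta> \<in> words12 \<and> markov (theta_omega k) < markov \<theta> \<and> markov \<theta> = lambda 0 \<theta> \<and> lambda 0 \<theta> < l"

text \<open>\<open>occurs_at \<theta> p u v\<close> says that \<open>\<theta>\<close> contains the string \<open>u @ v\<close> with the first entry of \<open>v\<close>,
  which plays the role of the starred entry, at position \<open>p\<close>.\<close>

definition occurs_at :: "(int \<Rightarrow> nat) \<Rightarrow> int \<Rightarrow> nat list \<Rightarrow> nat list \<Rightarrow> bool" where
  "occurs_at \<theta> p u v \<longleftrightarrow>
     (\<forall>j < length (u @ v). \<theta> (p - int (length u) + int j) = (u @ v) ! j)"

text \<open>\<open>occurs_left_periodic \<theta> p w u v\<close>: as \<open>occurs_at \<theta> p u v\<close>, and moreover \<open>u\<close> is preceded by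
  infinitely many copies of \<open>w\<close>, which fill all positions to the left.\<close>

definition occurs_left_periodic ::
  "(int \<Rightarrow> nat) \<Rightarrow> int \<Rightarrow> nat list \<Rightarrow> nat list \<Rightarrow> nat list \<Rightarrow> bool" where
  "occurs_left_periodic \<theta> p w u v \<longleftrightarrow>
     occurs_at \<theta> p u v \<and>
     (\<forall>i < 0. \<theta> (p - int (length u) + i) = w ! nat (i mod int (length w)))"

end

theory Submission
  imports Defs
begin

text \<open>If \<open>a 0 = 2\<close> is preceded by \<open>11\<close>, then \<open>[0; 1, 1, x] = 1 - [0; 2, x]\<close> gives
  \<open>lambda 0 = 3 + [0; R] - [0; 2, L]\<close>, where \<open>R\<close> is the word to the right and \<open>L\<close> the reversed
  word to the left of \<open>112\<^sup>*\<close>. Two continued fractions that first differ after a common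
  prefix \<open>u\<close> are at least \<open>(2/35) / K(u)\<^sup>2\<close> apart, those that share \<open>u\<close> at most \<open>(5/12) / K(u)\<^sup>2\<close>,
  where \<open>K(u)\<close> is the continuant; so every comparison of values reduces to a comparison of
  continuants of words made of blocks of \<open>2\<close>s separated by \<open>11\<close>.

  The threshold lies slightly above the value of \<open>gamma1 k\<close> at its distinguished entry. Some
  short words force a larger value at one of their own entries and are therefore forbidden.
  Reading \<open>\<theta>\<close> to the right and to the left from the given string, every entry that deviates from
  \<open>gamma1 k\<close> either completes a forbidden word or increases the value at the starred entry by more
  than any later deviation can recover. This uses only the bound on all \<open>lambda i \<theta>\<close>,
  hence it applies again at position \<open>- (6k+9)\<close>, and induction gives the periodic left half.\<close>

section \<open>Continued fractions with entries 1 and 2\<close>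

definition seq12 :: "(nat \<Rightarrow> nat) \<Rightarrow> bool" where
  "seq12 a \<longleftrightarrow> (\<forall>j. a j = 1 \<or> a j = 2)"

lemma seq12_shift: "seq12 a \<Longrightarrow> seq12 (\<lambda>j. a (n + j))"
  and seq12_Suc: "seq12 a \<Longrightarrow> seq12 (\<lambda>j. a (Suc j))"
  by (auto simp: seq12_def)

lemma seq12_bounds: "seq12 a \<Longrightarrow> 1 \<le> real (a j) \<and> real (a j) \<le> 2"
  unfolding seq12_def by (drule spec[of _ j]) auto

lemma cfrac_conv_bounds:
  assumes "seq12 a"
  shows "1 \<le> cfrac_conv a n \<and> cfrac_conv a n \<le> 3"
  using assms
proof (induction n arbitrary: a)
  case 0
  then show ?case using seq12_bounds[of a 0] unfolding cfrac_conv.simps by argo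
next
  case (Suc n)
  define x where "x = cfrac_conv (\<lambda>j. a (Suc j)) n"
  have "1 \<le> x"
    using Suc.IH[OF seq12_Suc[OF Suc.prems]] unfolding x_def by (rule conjunct1)
  then have "0 \<le> 1 / x" "1 / x \<le> 1"
    by simp_all
  moreover have "cfrac_conv a (Suc n) = real (a 0) + 1 / x"
    by (simp add: x_def)
  ultimately show ?case using seq12_bounds[OF Suc.prems, of 0] by argo
qed

lemma cfrac_conv_Suc_ge:
  assumes "seq12 a"
  shows "4/3 \<le> cfrac_conv a (Suc n)"
proof -
  define x where "x = cfrac_conv (\<lambda>j. a (Suc j)) n"
  have "1 \<le> x" "x \<le> 3"
    using cfrac_conv_bounds[OF seq12_Suc[OF assms], of n] unfolding x_def by simp_all
  then have "1 / 3 \<le> 1 / x"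
    by (intro divide_left_mono) simp_all
  moreover have "cfrac_conv a (Suc n) = real (a 0) + 1 / x"
    by (simp add: x_def)
  ultimately show ?thesis using seq12_bounds[OF assms, of 0] by argo
qed

text \<open>Consecutive tails satisfy \<open>x * y >= 4/3\<close>, so every further letter shrinks
  the difference of convergents by the factor 3/4. This geometric decay gives convergence.\<close>

lemma cfrac_conv_step:
  assumes "seq12 a"
  shows "\<bar>cfrac_conv a (Suc n) - cfrac_conv a n\<bar> \<le> (3/4) ^ n"
  using assms
proof (induction n arbitrary: a)
  case 0
  define x where "x = real (a (Suc 0))"
  have "a (Suc 0) = 1 \<or> a (Suc 0) = 2" using 0 unfolding seq12_def by (rule spec)
  then have "1 \<le> x" unfolding x_def by (elim disjE) simp_all
  then have "\<bar>1 / x\<bar> \<le> 1" by simp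
  moreover have "cfrac_conv a (Suc 0) - cfrac_conv a 0 = 1 / x"
    by (simp add: x_def)
  ultimately show ?case by simp
next
  case (Suc n)
  define x where "x = cfrac_conv (\<lambda>j. a (Suc j)) (Suc n)"
  define y where "y = cfrac_conv (\<lambda>j. a (Suc j)) n"
  have a': "seq12 (\<lambda>j. a (Suc j))" by (rule seq12_Suc[OF Suc.prems])
  have x: "4/3 \<le> x" and y: "1 \<le> y"
    unfolding x_def y_def
    by (rule cfrac_conv_Suc_ge[OF a'], rule conjunct1[OF cfrac_conv_bounds[OF a']])
  have "4/3 * 1 \<le> x * y" using x y by (intro mult_mono) simp_all
  then have xy: "0 < x * y" "1 / (x * y) \<le> 3/4" by (simp_all add: divide_le_eq)
  have "\<bar>x - y\<bar> \<le> (3/4) ^ n"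
    unfolding x_def y_def by (rule Suc.IH[OF a'])
  then have "\<bar>x - y\<bar> * (1 / (x * y)) \<le> (3/4) ^ n * (3/4)"
    using xy by (intro mult_mono) simp_all
  moreover have "1 / x - 1 / y = - ((x - y) * (1 / (x * y)))"
    using x y by (simp add: field_simps)
  then have "\<bar>1 / x - 1 / y\<bar> = \<bar>x - y\<bar> * (1 / (x * y))"
    using xy by (simp only: abs_minus_cancel abs_mult) simp
  moreover have "cfrac_conv a (Suc (Suc n)) - cfrac_conv a (Suc n) = 1 / x - 1 / y"
    unfolding x_def y_def by simp
  ultimately show ?case by (metis mult.commute power_Suc)
qed

lemma cfrac_conv_tendsto:
  assumes "seq12 a"
  shows "cfrac_conv a \<longlonglongrightarrow> cfrac a"
proof -
  have "summable (\<lambda>n. cfrac_conv a (Suc n) - cfrac_conv a n)"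
    by (rule summable_comparison_test[of _ "\<lambda>n. (3/4::real) ^ n"])
      (use cfrac_conv_step[OF assms] in \<open>auto intro!: summable_geometric simp del: cfrac_conv.simps\<close>)
  then obtain s where "(\<lambda>n. \<Sum>i<n. cfrac_conv a (Suc i) - cfrac_conv a i) \<longlonglongrightarrow> s"
    unfolding summable_def sums_def by blast
  then have "(\<lambda>n. cfrac_conv a n - cfrac_conv a 0) \<longlonglongrightarrow> s"
    by (simp add: sum_lessThan_telescope del: cfrac_conv.simps)
  then have "(\<lambda>n. cfrac_conv a n - cfrac_conv a 0 + cfrac_conv a 0) \<longlonglongrightarrow> s + cfrac_conv a 0"
    by (intro tendsto_intros)
  then have "convergent (cfrac_conv a)"
    by (auto simp: convergent_def simp del: cfrac_conv.simps)
  then show ?thesis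
    unfolding cfrac_def by (simp add: convergent_LIMSEQ_iff)
qed

lemma cfrac_bounds:
  assumes "seq12 a"
  shows "4/3 \<le> cfrac a" "cfrac a \<le> 3"
proof -
  have "(\<lambda>n. cfrac_conv a (Suc n)) \<longlonglongrightarrow> cfrac a"
    using cfrac_conv_tendsto[OF assms] by (rule LIMSEQ_Suc)
  moreover have "\<forall>n\<ge>0. 4/3 \<le> cfrac_conv a (Suc n)" "\<forall>n\<ge>0. cfrac_conv a (Suc n) \<le> 3"
    using cfrac_conv_Suc_ge[OF assms] cfrac_conv_bounds[OF assms] by blast+
  ultimately show "4/3 \<le> cfrac a" "cfrac a \<le> 3"
    using LIMSEQ_le_const LIMSEQ_le_const2 by metis+
qed

lemma cfrac_rec:
  assumes "seq12 (\<lambda>j. a (Suc j))"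
  shows "cfrac a = real (a 0) + 1 / cfrac (\<lambda>j. a (Suc j))"
proof -
  have "(\<lambda>n. real (a 0) + 1 / cfrac_conv (\<lambda>j. a (Suc j)) n)
      \<longlonglongrightarrow> real (a 0) + 1 / cfrac (\<lambda>j. a (Suc j))"
    using cfrac_bounds(1)[OF assms] by (intro tendsto_intros cfrac_conv_tendsto assms) auto
  then have "(\<lambda>n. cfrac_conv a (Suc n)) \<longlonglongrightarrow> real (a 0) + 1 / cfrac (\<lambda>j. a (Suc j))"
    by simp
  then have "cfrac_conv a \<longlonglongrightarrow> real (a 0) + 1 / cfrac (\<lambda>j. a (Suc j))"
    by (rule LIMSEQ_imp_Suc)
  then show ?thesis
    unfolding cfrac_def by (rule limI)
qed

text \<open>\<open>cval a\<close> is \<open>[0; a 0, a 1, \<dots>]\<close>.\<close>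

definition cval :: "(nat \<Rightarrow> nat) \<Rightarrow> real" where
  "cval a = 1 / cfrac a"

lemma cval_rec:
  assumes "seq12 a"
  shows "cval a = 1 / (real (a 0) + cval (\<lambda>j. a (Suc j)))"
  using cfrac_rec[OF seq12_Suc[OF assms]] by (simp add: cval_def)

lemma cval_bounds:
  assumes "seq12 a"
  shows "1/3 \<le> cval a" "cval a \<le> 3/4"
  using cfrac_bounds[OF assms] by (auto simp: cval_def divide_simps)

definition ray :: "(int \<Rightarrow> nat) \<Rightarrow> int \<Rightarrow> int \<Rightarrow> nat \<Rightarrow> nat" where
  "ray \<theta> p d = (\<lambda>j. \<theta> (p + d * int j))"

lemma seq12_ray: "\<theta> \<in> words12 \<Longrightarrow> seq12 (ray \<theta> p d)"
  by (auto simp: words12_def seq12_def ray_def)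

lemma ray_Suc: "(\<lambda>j. ray \<theta> p d (Suc j)) = ray \<theta> (p + d) d"
  by (auto simp: ray_def algebra_simps)

text \<open>The value is symmetric in the two directions, so one formula with a sign
  \<open>d\<close> serves both; entries at the right end of a block are treated with
  \<open>d = -1\<close>.\<close>

lemma lambda_rays:
  assumes "\<theta> \<in> words12" and d: "d = 1 \<or> d = -1"
  shows "lambda p \<theta> = real (\<theta> p) + cval (ray \<theta> (p + d) d) + cval (ray \<theta> (p - d) (- d))"
proof -
  have 1: "(\<lambda>j. \<theta> (p + int (Suc j))) = ray \<theta> (p + 1) 1"
    by (auto simp: ray_def algebra_simps)
  have 2: "(\<lambda>j. if Suc j = 0 then 0 else \<theta> (p - int (Suc j))) = ray \<theta> (p - 1) (- 1)"
    by (auto simp: ray_def algebra_simps)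
  have "lambda p \<theta> = real (\<theta> p) + cval (ray \<theta> (p + 1) 1) + cval (ray \<theta> (p - 1) (- 1))"
    using cfrac_rec[of "\<lambda>j. \<theta> (p + int j)"] cfrac_rec[of "\<lambda>j. if j = 0 then 0 else \<theta> (p - int j)"]
    unfolding lambda_def 1 2 by (simp add: seq12_ray assms(1) cval_def)
  then show ?thesis using d by auto
qed

section \<open>Finite prefixes and continuants\<close>

primrec starts :: "(nat \<Rightarrow> nat) \<Rightarrow> nat list \<Rightarrow> bool" where
  "starts a [] = True"
| "starts a (x # w) = (a 0 = x \<and> starts (\<lambda>j. a (Suc j)) w)"

lemma starts_append:
  "starts a (u @ v) \<longleftrightarrow> starts a u \<and> starts (\<lambda>j. a (length u + j)) v"
  by (induction u arbitrary: a) auto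

lemma starts_nth: "starts a w \<longleftrightarrow> (\<forall>j<length w. a j = w ! j)"
proof (induction w arbitrary: a)
  case (Cons x w)
  then show ?case by (auto simp: less_Suc_eq_0_disj nth_Cons')
qed simp

primrec cf :: "nat list \<Rightarrow> real \<Rightarrow> real" where
  "cf [] s = s"
| "cf (x # w) s = 1 / (real x + cf w s)"

text \<open>The denominator \<open>q_n + q_(n-1) * s\<close> of the Moebius map \<open>cf w\<close>,
  written as the product of the complete quotients. At \<open>s = 0\<close> it is the classical
  continuant.\<close>

primrec den :: "nat list \<Rightarrow> real \<Rightarrow> real" where
  "den [] s = 1"
| "den (x # w) s = (real x + cf w s) * den w s"

abbreviation continuant :: "nat list \<Rightarrow> real" where
  "continuant w \<equiv> den w 0"

lemma cval_cf:
  assumes "seq12 a" "starts a w"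
  shows "cval a = cf w (cval (\<lambda>j. a (length w + j)))"
  using assms
proof (induction w arbitrary: a)
  case (Cons x w)
  then show ?case using cval_rec[of a] seq12_Suc[of a] by simp
qed simp

lemma cf_append: "cf (u @ v) s = cf u (cf v s)"
  by (induction u) auto

lemma den_append: "den (u @ v) s = den u (cf v s) * den v s"
  by (induction u) (auto simp: cf_append)

lemma cf_nonneg: "0 \<le> s \<Longrightarrow> 0 \<le> cf w s"
  by (induction w) auto

lemma cf_le1: "set w \<subseteq> {1,2} \<Longrightarrow> 0 \<le> s \<Longrightarrow> s \<le> 1 \<Longrightarrow> cf w s \<le> 1"
  using cf_nonneg[of s] by (induction w) (fastforce simp: divide_simps)+

lemma den_affine:
  assumes "set w \<subseteq> {1,2}"
  shows "\<exists>c d. 0 \<le> c \<and> c \<le> d \<and> 1 \<le> d \<and> (\<forall>s\<ge>0. den w s = d + c * s)"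
proof -
  \<comment> \<open>Numerator \<open>b + a * s\<close> and denominator \<open>d + c * s\<close> go
    through the induction together. The new \<open>c <= d\<close> needs the old
    \<open>a + c <= b + d\<close>; the simpler \<open>a <= b\<close> already fails for the empty
    word.\<close>
  have "\<exists>a b c d. 0 \<le> a \<and> 0 \<le> b \<and> 0 \<le> c \<and> c \<le> d \<and> 1 \<le> d \<and> a + c \<le> b + d
      \<and> (\<forall>s\<ge>0. den w s = d + c * s \<and> cf w s * den w s = b + a * s)"
    using assms
  proof (induction w)
    case Nil
    show ?case by (rule exI[of _ 1], rule exI[of _ 0], rule exI[of _ 0], rule exI[of _ 1]) simp
  next
    case (Cons x w)
    then have "set w \<subseteq> {1,2}" by simp
    from Cons.IH[OF this] obtain a b c d where "0 \<le> a \<and> 0 \<le> b \<and> 0 \<le> c \<and> c \<le> d \<and> 1 \<le> d \<and> a + c \<le> b + d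
      \<and> (\<forall>s\<ge>0. den w s = d + c * s \<and> cf w s * den w s = b + a * s)"
      by (elim exE)
    then have *: "0 \<le> a" "0 \<le> b" "0 \<le> c" "c \<le> d" "1 \<le> d" "a + c \<le> b + d"
      "\<And>s. 0 \<le> s \<Longrightarrow> den w s = d + c * s" "\<And>s. 0 \<le> s \<Longrightarrow> cf w s * den w s = b + a * s"
      by blast+
    have x: "x = 1 \<or> x = 2" using Cons.prems by auto
    have new: "den (x # w) s = (x * d + b) + (x * c + a) * s"
      "cf (x # w) s * den (x # w) s = d + c * s" if "0 \<le> s" for s
    proof -
      have "den (x # w) s = x * den w s + cf w s * den w s" by (simp add: algebra_simps)
      then show "den (x # w) s = (x * d + b) + (x * c + a) * s"
        using *(7,8)[OF that] by (simp add: algebra_simps)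
      have "real x + cf w s > 0" using x cf_nonneg[OF that, of w] by auto
      then have "cf (x # w) s * den (x # w) s = den w s" by simp
      then show "cf (x # w) s * den (x # w) s = d + c * s" using *(7)[OF that] by simp
    qed
    show ?case
      by (rule exI[of _ c], rule exI[of _ d], rule exI[of _ "x * c + a"], rule exI[of _ "x * d + b"])
        (use new * x in auto)
  qed
  then show ?thesis by metis
qed

lemma continuant_ge1: "set w \<subseteq> {1,2} \<Longrightarrow> 1 \<le> continuant w"
  using den_affine[of w] by force

lemma den_bounds:
  assumes "set w \<subseteq> {1,2}" "0 \<le> s"
  shows "continuant w \<le> den w s" "den w s \<le> (1 + s) * continuant w"
proof -
  obtain c d where *: "0 \<le> c" "c \<le> d" "\<And>s. s \<ge> 0 \<Longrightarrow> den w s = d + c * s"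
    using den_affine[OF assms(1)] by metis
  have "c * s \<le> d * s" using * assms by (intro mult_right_mono) auto
  then show "continuant w \<le> den w s" "den w s \<le> (1 + s) * continuant w"
    using * assms(2) by (auto simp: algebra_simps)
qed

text \<open>The Moebius map of a word has determinant 1 or -1, and each letter flips the sign. Hence
  the parity of the common prefix decides which of two continued fractions is larger.\<close>

lemma cf_diff:
  assumes "set w \<subseteq> {1,2}" "0 \<le> s" "0 \<le> t"
  shows "cf w s - cf w t = (-1) ^ length w * (s - t) / (den w s * den w t)"
  using assms(1)
proof (induction w)
  case (Cons x w)
  then have IH: "cf w s - cf w t = (-1) ^ length w * (s - t) / (den w s * den w t)" by simp
  have x: "1 \<le> real x" using Cons.prems by auto
  have p: "real x + cf w s > 0" "real x + cf w t > 0"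
    using x cf_nonneg assms by (smt (verit))+
  have "cf (x # w) s - cf (x # w) t = - (cf w s - cf w t) / ((real x + cf w s) * (real x + cf w t))"
    using p by (simp add: field_simps)
  also have "\<dots> = (-1) ^ length (x # w) * (s - t) / (den (x # w) s * den (x # w) t)"
    unfolding IH by (simp add: mult_ac)
  finally show ?case .
qed simp

lemma starts_letters: "seq12 a \<Longrightarrow> starts a w \<Longrightarrow> set w \<subseteq> {1,2}"
proof (induction w arbitrary: a)
  case (Cons x w)
  then show ?case using Cons.IH[OF seq12_Suc] by (auto simp: seq12_def)
qed simp

lemma continuant_append:
  assumes "set u \<subseteq> {1,2}" "set v \<subseteq> {1,2}"
  shows "continuant u * continuant v \<le> continuant (u @ v)"
  using mult_right_mono[OF den_bounds(1)[OF assms(1) cf_nonneg[of 0 v]], of "continuant v"]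
    continuant_ge1[OF assms(2)] by (simp add: den_append)

lemma continuant_prefix:
  assumes "set u \<subseteq> {1,2}" "set v \<subseteq> {1,2}"
  shows "continuant u \<le> continuant (u @ v)"
  using continuant_append[OF assms] mult_left_mono[OF continuant_ge1[OF assms(2)], of "continuant u"]
    continuant_ge1[OF assms(1)] by argo

section \<open>Growth of the continuant when a letter 2 is inserted\<close>

lemma continuant_insert_affine:
  assumes "\<forall>s\<ge>0. den u s = d + c * s"
  shows "continuant (u @ 2 # v) = (d * (2 + cf v 0) + c) * continuant v"
    and "continuant (u @ v) = (d + c * cf v 0) * continuant v"
proof -
  have b: "0 \<le> cf v 0" by (rule cf_nonneg) simp
  then have "den u (1 / (2 + cf v 0)) * (2 + cf v 0) = d * (2 + cf v 0) + c"
    using assms[rule_format, of "1 / (2 + cf v 0)"] by (simp add: field_simps)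
  then show "continuant (u @ 2 # v) = (d * (2 + cf v 0) + c) * continuant v"
    by (simp add: den_append flip: mult.assoc)
  show "continuant (u @ v) = (d + c * cf v 0) * continuant v"
    using assms b by (simp add: den_append)
qed

text \<open>With \<open>den u s = d + c * s\<close> and \<open>b = cf v 0\<close> the quotient is
  \<open>(d * (2 + b) + c) / (d + c * b)\<close>, which lies in [2, 3] because
  \<open>0 <= c <= d\<close> and \<open>0 <= b <= 1\<close>.\<close>

lemma continuant_insert:
  assumes "set u \<subseteq> {1,2}" "set v \<subseteq> {1,2}"
  shows "2 * continuant (u @ v) \<le> continuant (u @ 2 # v)"
    and "continuant (u @ 2 # v) \<le> 3 * continuant (u @ v)"
proof -
  define b where "b = cf v 0"
  have b: "0 \<le> b" "b \<le> 1" unfolding b_def using cf_nonneg cf_le1[OF assms(2)] by auto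
  obtain c d where cd: "0 \<le> c" "c \<le> d" "\<forall>s\<ge>0. den u s = d + c * s"
    using den_affine[OF assms(1)] by metis
  have v: "0 \<le> continuant v" using continuant_ge1[OF assms(2)] by linarith
  note e = continuant_insert_affine[of u d c v, OF cd(3), folded b_def]
  have cb: "0 \<le> c * b" "c * b \<le> c" "c * b \<le> d * b" "(d - c) * b \<le> (d - c)"
    using cd b by (auto intro: mult_left_le mult_right_mono)
  have "2 * (d + c * b) \<le> d * (2 + b) + c" 
    using cb by (simp add: algebra_simps)
  from mult_right_mono[OF this v] show "2 * continuant (u @ v) \<le> continuant (u @ 2 # v)"
    unfolding e by (simp only: mult.assoc)
  have "d * (2 + b) + c \<le> 3 * (d + c * b)"
    using cb by (simp add: algebra_simps)
  from mult_right_mono[OF this v] show "continuant (u @ 2 # v) \<le> 3 * continuant (u @ v)"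
    unfolding e by (simp only: mult.assoc)
qed

text \<open>A neighbouring 2 (or the end of the word) on each side gives \<open>2 * c <= d\<close>
  and \<open>b <= 1/2\<close>, which lowers the factor 3 to 5/2. With 3 the comparison in
  \<open>continuant_AB\<close> would yield 8/3 in place of 96/25, too little for
  \<open>gap_minus_close\<close>.\<close>

lemma continuant_insert_in_block:
  assumes "set u \<subseteq> {1,2}" "set v \<subseteq> {1,2}"
    and u: "u = [] \<or> (\<exists>u'. u = u' @ [2])" and v: "v = [] \<or> (\<exists>v'. v = 2 # v')"
  shows "continuant (u @ 2 # v) \<le> 5/2 * continuant (u @ v)"
proof -
  define b where "b = cf v 0"
  have b: "0 \<le> b" "b \<le> 1/2"
    using v cf_nonneg[of 0] unfolding b_def by (auto simp: divide_simps)
  have "\<exists>c d. 0 \<le> c \<and> 2 * c \<le> d \<and> (\<forall>s\<ge>0. den u s = d + c * s)"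
    using u
  proof
    assume "u = []"
    then show ?thesis by (intro exI[of _ 0] exI[of _ 1]) auto
  next
    assume "\<exists>u'. u = u' @ [2]"
    then obtain u' where u': "u = u' @ [2]" by blast
    then obtain c d where cd: "0 \<le> c" "c \<le> d" "\<And>s. 0 \<le> s \<Longrightarrow> den u' s = d + c * s"
      using den_affine[of u'] assms(1) by auto
    have "den u s = (2 * d + c) + d * s" if "0 \<le> s" for s
      using cd(3)[of "1 / (2 + s)"] that unfolding u' by (simp add: den_append field_simps)
    then show ?thesis using cd by (intro exI[of _ d] exI[of _ "2 * d + c"]) auto
  qed
  then obtain c d where cd: "0 \<le> c" "2 * c \<le> d" "\<forall>s\<ge>0. den u s = d + c * s"
    by metis
  have v0: "0 \<le> continuant v" using continuant_ge1[OF assms(2)] by linarith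
  note e = continuant_insert_affine[of u d c v, OF cd(3), folded b_def]
  have "(d - 2 * c) * b \<le> (d - 2 * c) * (1/2)" "0 \<le> c * b" "c * b \<le> c * (1/2)"
    using cd b mult_left_mono[OF b(2), of "d - 2 * c"] mult_left_mono[OF b(2), of c] by auto
  then have "d * (2 + b) + c \<le> 5/2 * (d + c * b)"
    by (simp add: algebra_simps)
  from mult_right_mono[OF this v0] show ?thesis
    unfolding e by (simp only: mult.assoc)
qed

section \<open>Distance of two continued fractions with a common prefix\<close>

lemma cval_close:
  assumes "seq12 a" "seq12 b" "starts a u" "starts b u"
  shows "\<bar>cval a - cval b\<bar> \<le> (5/12) / (continuant u)\<^sup>2"
proof -
  define s t where "s = cval (\<lambda>j. a (length u + j))" and "t = cval (\<lambda>j. b (length u + j))"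
  have st: "1/3 \<le> s" "s \<le> 3/4" "1/3 \<le> t" "t \<le> 3/4"
    unfolding s_def t_def using cval_bounds seq12_shift assms by blast+
  have u: "set u \<subseteq> {1,2}" using starts_letters assms by blast
  have d: "continuant u \<le> den u s" "continuant u \<le> den u t" "1 \<le> continuant u"
    using den_bounds[OF u] continuant_ge1[OF u] st by auto
  then have d2: "(continuant u)\<^sup>2 \<le> den u s * den u t"
    unfolding power2_eq_square by (intro mult_mono) auto
  have "cval a - cval b = (-1) ^ length u * (s - t) / (den u s * den u t)"
    using cval_cf[OF assms(1,3)] cval_cf[OF assms(2,4)] cf_diff[OF u, of s t] st
    by (simp add: s_def t_def)
  then have "\<bar>cval a - cval b\<bar> = \<bar>s - t\<bar> / (den u s * den u t)"
    using d by (simp add: abs_mult power_abs)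
  \<comment> \<open>5/12 = 3/4 - 1/3 is the length of the interval containing both tail
    values.\<close>
  also have "\<bar>s - t\<bar> \<le> 5/12" using st by linarith
  then have "\<bar>s - t\<bar> / (den u s * den u t) \<le> (5/12) / (continuant u)\<^sup>2"
    using d2 d by (intro frac_le) auto
  finally show ?thesis .
qed

lemma cval_first:
  assumes "seq12 a" 
  shows "a 0 = 1 \<Longrightarrow> 4/7 \<le> cval a" "a 0 = 2 \<Longrightarrow> 4/11 \<le> cval a \<and> cval a \<le> 3/7"
proof -
  define s where "s = cval (\<lambda>j. a (Suc j))"
  have s: "1/3 \<le> s" "s \<le> 3/4" "cval a = 1 / (real (a 0) + s)"
    unfolding s_def using cval_rec[OF assms] cval_bounds[OF seq12_Suc[OF assms]] by blast+
  show "4/7 \<le> cval a" if "a 0 = 1"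
    unfolding s(3) that using s(1,2) by (simp add: field_simps)
  show "4/11 \<le> cval a \<and> cval a \<le> 3/7" if "a 0 = 2"
    unfolding s(3) that using s(1,2) by (simp add: field_simps)
qed

text \<open>The interval \<open>[1/3, 3/4]\<close> contains all values \<open>[0; a 0, a 1, \<dots>]\<close>; its images under
  \<open>s \<mapsto> 1/(1+s)\<close> and \<open>s \<mapsto> 1/(2+s)\<close> are \<open>1/7\<close> apart.\<close>

lemma cval_gap:
  assumes "seq12 a" "seq12 b" "starts a (u @ [1])" "starts b (u @ [2])"
  shows "(2/35) / (continuant u)\<^sup>2 \<le> (-1) ^ length u * (cval a - cval b)"
proof -
  define s t where "s = cval (\<lambda>j. a (length u + j))" and "t = cval (\<lambda>j. b (length u + j))"
  have ab: "starts a u" "starts b u" "a (length u) = 1" "b (length u) = 2"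
    using assms(3,4) by (auto simp: starts_append)
  have st: "4/7 \<le> s" "s \<le> 3/4" "4/11 \<le> t" "t \<le> 3/7"
    unfolding s_def t_def using cval_first[of "\<lambda>j. a (length u + j)"] cval_first[of "\<lambda>j. b (length u + j)"]
      cval_bounds[of "\<lambda>j. a (length u + j)"] ab seq12_shift assms by auto
  have u: "set u \<subseteq> {1,2}" using starts_letters[OF assms(1) ab(1)] .
  define K where "K = continuant u"
  have d: "den u s \<le> (1 + s) * K" "den u t \<le> (1 + t) * K" "1 \<le> K" "K \<le> den u s" "K \<le> den u t"
    using den_bounds[OF u] continuant_ge1[OF u] st unfolding K_def by auto
  have "den u s \<le> 7/4 * K" "den u t \<le> 10/7 * K"
    using d st mult_right_mono[of "1 + s" "7/4" K] mult_right_mono[of "1 + t" "10/7" K] by argo+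
  then have "den u s * den u t \<le> (7/4 * K) * (10/7 * K)"
    using d by (intro mult_mono) auto
  then have "den u s * den u t \<le> 5/2 * K\<^sup>2" by (simp add: power2_eq_square)
  \<comment> \<open>The tails are at least 1/7 = 4/7 - 3/7 apart, and the two denominators exceed
    the continuant by at most the factors 7/4 and 10/7, with product 5/2. The quotient is the
    constant 2/35.\<close>
  then have "(1/7) / (5/2 * K\<^sup>2) \<le> (s - t) / (den u s * den u t)"
    using d st by (intro frac_le) auto
  moreover have "cval a - cval b = (-1) ^ length u * ((s - t) / (den u s * den u t))"
    using cval_cf[OF assms(1) ab(1)] cval_cf[OF assms(2) ab(2)] cf_diff[OF u, of s t] st
    by (simp add: s_def t_def)
  then have "(-1) ^ length u * (cval a - cval b) = (s - t) / (den u s * den u t)"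
    by (simp add: power_add[symmetric] flip: mult.assoc)
  ultimately show ?thesis unfolding K_def by simp
qed

lemma cval_gap_even:
  assumes "seq12 a" "seq12 b" "starts a (u @ [1])" "starts b (u @ [2])" "even (length u)"
  shows "cval b + (2/35) / (continuant u)\<^sup>2 \<le> cval a"
  using cval_gap[OF assms(1-4)] assms(5) by simp

lemma cval_gap_odd:
  assumes "seq12 a" "seq12 b" "starts a (u @ [1])" "starts b (u @ [2])" "odd (length u)"
  shows "cval a + (2/35) / (continuant u)\<^sup>2 \<le> cval b"
  using cval_gap[OF assms(1-4)] assms(5) by simp

section \<open>Factors of bi-infinite words\<close>

definition occ :: "(int \<Rightarrow> nat) \<Rightarrow> int \<Rightarrow> nat list \<Rightarrow> bool" where
  "occ \<theta> q w \<longleftrightarrow> (\<forall>j<length w. \<theta> (q + int j) = w ! j)"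

lemma starts_ray: "starts (ray \<theta> p 1) w \<longleftrightarrow> occ \<theta> p w"
  by (simp add: starts_nth occ_def ray_def)

lemma occ_append: "occ \<theta> q (u @ v) \<longleftrightarrow> occ \<theta> q u \<and> occ \<theta> (q + int (length u)) v"
proof -
  have *: "ray \<theta> q 1 (length u + j) = ray \<theta> (q + int (length u)) 1 j" for j
    by (simp add: ray_def algebra_simps)
  show ?thesis by (simp flip: starts_ray add: starts_append *)
qed

lemma occ_Nil [simp]: "occ \<theta> q []"
  by (simp add: occ_def)

lemma occ_Cons: "occ \<theta> q (x # v) \<longleftrightarrow> \<theta> q = x \<and> occ \<theta> (q + 1) v"
  using occ_append[of \<theta> q "[x]" v] by (simp add: occ_def)

lemma starts_ray_neg: "starts (ray \<theta> p (-1)) w \<longleftrightarrow> occ \<theta> (p - int (length w) + 1) (rev w)"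
proof (induction w arbitrary: p)
  case (Cons x w)
  have "starts (ray \<theta> p (-1)) (x # w) \<longleftrightarrow> \<theta> p = x \<and> starts (ray \<theta> (p - 1) (-1)) w"
    by (simp add: ray_Suc) (simp add: ray_def)
  then show ?case using Cons.IH[of "p - 1"] by (auto simp: occ_append occ_Cons)
qed simp

text \<open>Values are unchanged under reversal, so a word is forbidden together with its reversal;
  both are covered at once.\<close>

definition has :: "(int \<Rightarrow> nat) \<Rightarrow> nat list \<Rightarrow> bool" where
  "has \<theta> w \<longleftrightarrow> (\<exists>q. occ \<theta> q w \<or> occ \<theta> q (rev w))"

lemma has_factor: "has \<theta> (x @ w @ y) \<Longrightarrow> has \<theta> w"
  by (auto simp: has_def occ_append)

lemma has_rev: "has \<theta> (rev w) \<longleftrightarrow> has \<theta> w"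
  by (auto simp: has_def)

text \<open>With \<open>d = -1\<close> the word is read backwards. The leading \<open>2\<close> of \<open>left_ray\<close> replaces the letters \<open>11\<close>
  next to position \<open>p\<close>.\<close>

definition right_ray :: "(int \<Rightarrow> nat) \<Rightarrow> int \<Rightarrow> int \<Rightarrow> nat \<Rightarrow> nat" where
  "right_ray \<theta> p d = ray \<theta> (p + d) d"

definition left_ray :: "(int \<Rightarrow> nat) \<Rightarrow> int \<Rightarrow> int \<Rightarrow> nat \<Rightarrow> nat" where
  "left_ray \<theta> p d = case_nat 2 (ray \<theta> (p - 3 * d) (- d))"

lemma seq12_sides:
  "\<theta> \<in> words12 \<Longrightarrow> seq12 (right_ray \<theta> p d)"
  "\<theta> \<in> words12 \<Longrightarrow> seq12 (left_ray \<theta> p d)"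
  using seq12_ray[of \<theta>] by (auto simp: right_ray_def left_ray_def seq12_def split: nat.split)

lemma left_ray_simps [simp]:
  "left_ray \<theta> p d 0 = 2"
  "(\<lambda>j. left_ray \<theta> p d (Suc j)) = ray \<theta> (p - 3 * d) (- d)"
  by (simp_all add: left_ray_def)

lemma lambda_star:
  assumes "\<theta> \<in> words12" "d = 1 \<or> d = -1" "\<theta> p = 2" "\<theta> (p - d) = 1" "\<theta> (p - 2 * d) = 1"
  shows "lambda p \<theta> = 3 + cval (right_ray \<theta> p d) - cval (left_ray \<theta> p d)"
proof -
  define t where "t = cval (ray \<theta> (p - 3 * d) (- d))"
  have t: "1/3 \<le> t" "t \<le> 3/4"
    unfolding t_def using cval_bounds[OF seq12_ray[OF assms(1)]] by auto
  have 1: "p - d + - d = p - 2 * d" "p - 2 * d + - d = p - 3 * d" by auto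
  have "cval (ray \<theta> (p - d) (- d)) = 1 / (1 + cval (ray \<theta> (p - 2 * d) (- d)))"
    using cval_rec[OF seq12_ray[OF assms(1)], of "p - d" "- d"] assms(4)
    unfolding ray_Suc 1 by (simp add: ray_def)
  also have "cval (ray \<theta> (p - 2 * d) (- d)) = 1 / (1 + t)"
    using cval_rec[OF seq12_ray[OF assms(1)], of "p - 2 * d" "- d"] assms(5)
    unfolding ray_Suc 1 t_def by (simp add: ray_def)
  also have "1 / (1 + 1 / (1 + t)) = 1 - 1 / (2 + t)"
    using t by (simp add: field_simps)
  also have "1 / (2 + t) = cval (left_ray \<theta> p d)"
    using cval_rec[OF seq12_sides(2)[OF assms(1)], of p d]
    by (simp add: left_ray_def t_def)
  finally show ?thesis
    using lambda_rays[OF assms(1,2), of p] assms(3) by (simp add: right_ray_def)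
qed

text \<open>Translates an occurrence into a value at the 2 of \<open>[1,1,2]\<close>. A reversed
  occurrence is read with \<open>d = -1\<close>, so the exclusion arguments have to treat only one
  direction.\<close>

lemma has_star:
  assumes "\<theta> \<in> words12" "has \<theta> (u @ [1,1,2] @ v)"
  shows "\<exists>p R L. seq12 R \<and> seq12 L \<and> starts R v \<and> starts L (2 # rev u) \<and>
    lambda p \<theta> = 3 + cval R - cval L"
proof -
  define P where "P p d \<longleftrightarrow> \<theta> p = 2 \<and> \<theta> (p - d) = 1 \<and> \<theta> (p - 2 * d) = 1 \<and>
    starts (right_ray \<theta> p d) v \<and> starts (left_ray \<theta> p d) (2 # rev u)" for p d
  have P: ?thesis if "P p d" "d = 1 \<or> d = -1" for p d
    using lambda_star[OF assms(1) that(2), of p] seq12_sides[OF assms(1), of p d] that(1)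
    unfolding P_def by blast
  obtain q where "occ \<theta> q (u @ [1,1,2] @ v) \<or> occ \<theta> q (rev (u @ [1,1,2] @ v))"
    using assms(2) unfolding has_def by blast
  then show ?thesis
  proof
    assume "occ \<theta> q (u @ [1,1,2] @ v)"
    then have "P (q + int (length u) + 2) 1"
      unfolding P_def
      by (simp add: occ_append occ_Cons right_ray_def starts_ray starts_ray_neg algebra_simps)
    then show ?thesis by (rule P) simp
  next
    assume "occ \<theta> q (rev (u @ [1,1,2] @ v))"
    then have "P (q + int (length v)) (-1)"
      unfolding P_def
      by (simp add: occ_append occ_Cons right_ray_def starts_ray starts_ray_neg algebra_simps)
    then show ?thesis by (rule P) simp
  qed
qed

section \<open>Comparison of continuants of block words\<close>

declare den.simps(2) [simp del]

lemma set_twos [simp]: "set (twos n) \<subseteq> {Suc 0, 2}"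
  by auto

lemma twos_join: "replicate a x @ replicate b x @ z = replicate (a + b) x @ z"
  by (simp add: replicate_add)

lemmas word_simps = twos_join replicate_app_Cons_same replicate_add[symmetric]

lemma continuant_block_ge:
  assumes "set x \<subseteq> {1,2}" "set y \<subseteq> {1,2}"
  shows "2 * continuant (x @ twos n @ y) \<le> continuant (x @ twos (Suc n) @ y)"
  using continuant_insert(1)[of x "twos n @ y"] assms by auto

lemma continuant_block_le3:
  assumes "set x \<subseteq> {1,2}" "set y \<subseteq> {1,2}"
  shows "continuant (x @ twos (Suc n) @ y) \<le> 3 * continuant (x @ twos n @ y)"
  using continuant_insert(2)[of x "twos n @ y"] assms by auto

text \<open>For \<open>2 <= n\<close> the new letter can be placed between two 2s of the block,
  which makes the factor 5/2 available.\<close>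

lemma continuant_block_le:
  assumes "set x \<subseteq> {1,2}" "set y \<subseteq> {1,2}" "2 \<le> n"
  shows "continuant (x @ twos (Suc n) @ y) \<le> 5/2 * continuant (x @ twos n @ y)"
proof -
  obtain m where n: "n = Suc (Suc m)"
    using assms(3) by (metis add_2_eq_Suc le_Suc_ex)
  show ?thesis
    using continuant_insert_in_block[of "x @ [2]" "2 # twos m @ y"] assms(1,2) unfolding n by auto
qed

lemma continuant_block_mono:
  assumes "set x \<subseteq> {1,2}" "set y \<subseteq> {1,2}" "m \<le> n"
  shows "continuant (x @ twos m @ y) \<le> continuant (x @ twos n @ y)"
  using assms(3)
proof (induction n rule: dec_induct)
  case (step n)
  have "1 \<le> continuant (x @ twos n @ y)"
    using assms by (intro continuant_ge1) auto
  then show ?case using continuant_block_ge[OF assms(1,2), of n] step.IH by linarith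
qed simp

text \<open>The first four appended letters \<open>[1,1,2,2]\<close> have continuant 12.\<close>

lemma continuant_snoc_block:
  assumes "set u \<subseteq> {1,2}" "1 \<le> k"
  shows "12 * continuant u \<le> continuant (u @ [1,1] @ twos (2 * k))"
proof -
  have "twos (2 * k) = [2,2] @ twos (2 * k - 2)"
    using assms(2) by (simp add: Suc_diff_Suc numeral_2_eq_2 flip: replicate_Suc)
  then have e: "u @ [1,1] @ twos (2 * k) = (u @ [1,1,2,2]) @ twos (2 * k - 2)" by simp
  have "continuant u * 12 \<le> continuant (u @ [1,1,2,2])"
    using continuant_append[of u "[1,1,2,2]"] assms by (simp add: den.simps(2))
  also have "\<dots> \<le> continuant (u @ [1,1] @ twos (2 * k))"
    unfolding e using assms by (intro continuant_prefix) auto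
  finally show ?thesis by simp
qed

text \<open>The right ray of \<open>gamma1 k\<close> at its star, up to the last block before the
  final \<open>[1,1]\<close> and the infinite run of 2s.\<close>

definition wordA :: "nat \<Rightarrow> nat list" where
  "wordA k = twos (2*k) @ [1,1] @ twos (2*k+2) @ [1,1] @ twos (2*k) @ [1,1] @ twos (2*k+1) @ [1,1] @ twos (2*k+2)"

text \<open>The left ray of \<open>gamma1 k\<close> at its star, read leftwards. The first block has
  length \<open>2*k+1\<close> because it includes the 2 that stands for the adjacent letters
  11.\<close>

definition wordB :: "nat \<Rightarrow> nat list" where
  "wordB k = twos (2*k+1) @ [1,1] @ twos (2*k+2) @ [1,1] @ twos (2*k+1) @ [1,1] @ twos (2*k) @ [1,1] @ twos (2*k+2)"

lemma wordAB_letters: "set (wordA k) \<subseteq> {1,2}" "set (wordB k) \<subseteq> {1,2}"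
  by (auto simp: wordA_def wordB_def)

text \<open>Both words arise from the word with block lengths \<open>2k, 2k+2, 2k, 2k, 2k+2\<close> by inserting
  letters \<open>2\<close>.\<close>

lemma continuant_AB:
  assumes "1 \<le> k"
  shows "96/25 * continuant (wordB k) \<le> continuant (wordA k @ [1,1] @ twos (2*k))"
    and "96/25 * continuant (wordA k) \<le> continuant (wordB k @ [1,1] @ twos (2*k))"
proof -
  define c where "c i j l = continuant (twos i @ [1,1] @ twos (2*k+2) @ [1,1] @ twos j @ [1,1] @ twos l @ [1,1] @ twos (2*k+2))" for i j l
  have A: "continuant (wordA k) = c (2*k) (2*k) (Suc (2*k))"
    and B: "continuant (wordB k) = c (Suc (2*k)) (Suc (2*k)) (2*k)"
    unfolding c_def wordA_def wordB_def Suc_eq_plus1 by (rule refl)+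
  have i: "2 * c i j l \<le> c (Suc i) j l" "2 \<le> i \<Longrightarrow> c (Suc i) j l \<le> 5/2 * c i j l" for i j l
    using continuant_block_ge[of "[]" "[1,1] @ twos (2*k+2) @ [1,1] @ twos j @ [1,1] @ twos l @ [1,1] @ twos (2*k+2)" i]
      continuant_block_le[of "[]" "[1,1] @ twos (2*k+2) @ [1,1] @ twos j @ [1,1] @ twos l @ [1,1] @ twos (2*k+2)" i]
    unfolding c_def by auto
  have j: "2 * c i j l \<le> c i (Suc j) l" "2 \<le> j \<Longrightarrow> c i (Suc j) l \<le> 5/2 * c i j l" for i j l
    using continuant_block_ge[of "twos i @ [1,1] @ twos (2*k+2) @ [1,1]" "[1,1] @ twos l @ [1,1] @ twos (2*k+2)" j]
      continuant_block_le[of "twos i @ [1,1] @ twos (2*k+2) @ [1,1]" "[1,1] @ twos l @ [1,1] @ twos (2*k+2)" j]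
    unfolding c_def by auto
  have l: "2 * c i j l \<le> c i j (Suc l)" "2 \<le> l \<Longrightarrow> c i j (Suc l) \<le> 5/2 * c i j l" for i j l
    using continuant_block_ge[of "twos i @ [1,1] @ twos (2*k+2) @ [1,1] @ twos j @ [1,1]" "[1,1] @ twos (2*k+2)" l]
      continuant_block_le[of "twos i @ [1,1] @ twos (2*k+2) @ [1,1] @ twos j @ [1,1]" "[1,1] @ twos (2*k+2)" l]
    unfolding c_def by auto
  have k: "2 \<le> 2 * k" "2 \<le> Suc (2 * k)" using assms by auto
  have c: "1 \<le> c i j l" for i j l
    unfolding c_def by (intro continuant_ge1) auto
  \<comment> \<open>Starting from \<open>c (2*k) (2*k) (2*k)\<close>, \<open>wordB\<close> needs two
    insertions (factor at most 25/4) and \<open>wordA\<close> one (factor at least 2), whence 25/8.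
    The factor 12 of the appended block leaves 12 / (25/8) = 96/25.\<close>
  have "continuant (wordB k) \<le> 25/8 * continuant (wordA k)"
    unfolding A B using i(2)[OF k(1), of "Suc (2*k)" "2*k"] j(2)[OF k(1), of "2*k" "2*k"]
      l(1)[of "2*k" "2*k" "2*k"] by linarith
  then show "96/25 * continuant (wordB k) \<le> continuant (wordA k @ [1,1] @ twos (2*k))"
    using continuant_snoc_block[OF wordAB_letters(1) assms, of k] by linarith
  have "continuant (wordA k) \<le> 5/8 * continuant (wordB k)"
    unfolding A B using i(1)[of "2*k" "Suc (2*k)" "2*k"] j(1)[of "2*k" "2*k" "2*k"]
      l(2)[OF k(1), of "2*k" "2*k"] by linarith
  then show "96/25 * continuant (wordA k) \<le> continuant (wordB k @ [1,1] @ twos (2*k))"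
    using continuant_snoc_block[OF wordAB_letters(2) assms, of k] continuant_ge1[OF wordAB_letters(2), of k] by linarith
qed

section \<open>Reading a ray letter by letter\<close>

lemma starts_digit: "seq12 a \<Longrightarrow> starts a w \<Longrightarrow> starts a (w @ [1]) \<or> starts a (w @ [2])"
  by (auto simp: starts_append seq12_def)

lemma starts_run:
  assumes "seq12 a" "starts a w"
  shows "starts a (w @ twos n) \<or> (\<exists>m<n. starts a (w @ twos m @ [1]))"
proof (induction n)
  case (Suc n)
  then show ?case
  proof
    assume "starts a (w @ twos n)"
    from starts_digit[OF assms(1) this] show ?thesis
      by (auto simp: replicate_append_same simp flip: replicate_Suc)
  qed (use less_SucI in blast)
qed (use assms(2) in simp)

lemma has_factorI: "has \<theta> w \<Longrightarrow> w = x @ f @ y \<Longrightarrow> has \<theta> f"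
  using has_factor by blast

text \<open>One ray deviates after a prefix with continuant \<open>x\<close>, the other is known
  along a prefix with continuant \<open>y\<close>. The constant 2/35 - (5/12) / (96/25)^2 is about
  0.0289, so 1/40 remains.\<close>

lemma gap_minus_close:
  fixes x y :: real
  assumes "1 \<le> x" "96/25 * x \<le> y"
  shows "(1/40) / x\<^sup>2 \<le> (2/35) / x\<^sup>2 - (5/12) / y\<^sup>2"
proof -
  have "(96/25 * x)\<^sup>2 \<le> y\<^sup>2" using assms by (intro power_mono) auto
  then have "(5/12) / y\<^sup>2 \<le> (5/12) / (96/25 * x)\<^sup>2"
    using assms by (intro divide_left_mono) auto
  also have "\<dots> \<le> (2/35 - 1/40) / x\<^sup>2"
    using assms by (simp add: power_mult_distrib divide_simps)
  finally show ?thesis by (simp add: diff_divide_distrib)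
qed

text \<open>\<open>R0\<close> and \<open>L0\<close> will be the rays of \<open>gamma1 k\<close> at the entry \<open>2\<^sup>*\<close>; only the two
  prefixes matter for the extension argument.\<close>

locale threshold =
  fixes k :: nat and R0 L0 :: "nat \<Rightarrow> nat"
  assumes k: "1 \<le> k"
    and seq: "seq12 R0" "seq12 L0"
    and R0: "starts R0 (wordA k @ [1,1] @ twos (2*k))"
    and L0: "starts L0 (wordB k @ [1,1] @ twos (2*k))"
begin

definition E0 :: real where "E0 = cval R0 - cval L0"

text \<open>The sum dominates the continuant of every prefix of either word, and 1/1000 does not
  exceed any constant left over by a later comparison, so one margin serves all arguments.\<close>

definition margin :: real where
  "margin = 1 / (1000 * (continuant (wordA k) + continuant (wordB k))\<^sup>2)"

text \<open>Unlike admissibility this does not single out position 0, so it applies unchanged at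
  every star.\<close>

definition low :: "(int \<Rightarrow> nat) \<Rightarrow> bool" where
  "low \<theta> \<longleftrightarrow> \<theta> \<in> words12 \<and> (\<forall>p. lambda p \<theta> < 3 + E0 + margin)"

lemma margin_pos: "0 < margin"
  using continuant_ge1[OF wordAB_letters(1), of k] continuant_ge1[OF wordAB_letters(2), of k]
  by (simp add: margin_def)

lemma margin_le:
  assumes "set u \<subseteq> {1,2}" "continuant u \<le> continuant (wordA k) \<or> continuant u \<le> continuant (wordB k)" "1/1000 \<le> c"
  shows "margin \<le> c / (continuant u)\<^sup>2"
proof -
  define m where "m = continuant (wordA k) + continuant (wordB k)"
  have "1 \<le> continuant u" "continuant u \<le> m"
    using continuant_ge1[OF assms(1)] continuant_ge1[OF wordAB_letters(1), of k]
      continuant_ge1[OF wordAB_letters(2), of k] assms(2) unfolding m_def by auto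
  then have "(1/1000) / m\<^sup>2 \<le> c / (continuant u)\<^sup>2"
    using assms(3) by (intro frac_le power_mono) auto
  then show ?thesis by (simp add: margin_def m_def)
qed

text \<open>The scheme for forbidden words: exhibit an entry 2 after 11 whose surroundings alone
  force the difference of the rays up to the threshold.\<close>

lemma no_star:
  assumes "low \<theta>" "has \<theta> (u @ [1,1,2] @ v)"
    and "\<And>R L. seq12 R \<Longrightarrow> seq12 L \<Longrightarrow> starts R v \<Longrightarrow> starts L (2 # rev u) \<Longrightarrow> E0 + margin \<le> cval R - cval L"
  shows False
proof -
  obtain p R L where *: "seq12 R" "seq12 L" "starts R v" "starts L (2 # rev u)"
    "lambda p \<theta> = 3 + cval R - cval L"
    using has_star[OF _ assms(2)] assms(1) unfolding low_def by blast
  have "lambda p \<theta> < 3 + E0 + margin" using assms(1) unfolding low_def by blast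
  then show False using assms(3)[OF *(1-4)] *(5) by linarith
qed

text \<open>Both rays begin with \<open>twos (2*k)\<close>, of even length; then \<open>R0\<close>
  continues with 1,1,2 and \<open>L0\<close> with 2. The general constant 5/12 is too weak for
  \<open>E0_margin\<close>; the known letters improve it to 42/187, slightly below 8/35.\<close>

lemma E0_bounds:
  shows "(2/35) / (continuant (twos (2*k)))\<^sup>2 \<le> E0" "E0 \<le> (42/187) / (continuant (twos (2*k)))\<^sup>2"
proof -
  let ?u = "twos (2*k)"
  have "starts R0 (?u @ [1,1,2] @ twos (2*k+1) @ [1,1] @ twos (2*k) @ [1,1] @ twos (2*k+1) @ [1,1] @ twos (2*k+2) @ [1,1] @ twos (2*k))"
    using R0 by (simp add: wordA_def)
  then have R: "starts R0 (?u @ [1])" "starts R0 ?u" "starts (\<lambda>j. R0 (length ?u + j)) [1,1,2]"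
    unfolding starts_append by auto
  have "starts L0 (?u @ [2] @ [1,1] @ twos (2*k+2) @ [1,1] @ twos (2*k+1) @ [1,1] @ twos (2*k) @ [1,1] @ twos (2*k+2) @ [1,1] @ twos (2*k))"
    using L0 by (simp add: wordB_def word_simps)
  then have L: "starts L0 (?u @ [2])" "starts L0 ?u" "starts (\<lambda>j. L0 (length ?u + j)) [2]"
    unfolding starts_append by auto
  show "(2/35) / (continuant ?u)\<^sup>2 \<le> E0"
    unfolding E0_def using cval_gap_even[OF seq R(1) L(1)] by simp
  define s t where "s = cval (\<lambda>j. R0 (length ?u + j))" and "t = cval (\<lambda>j. L0 (length ?u + j))"
  define r where "r = cval (\<lambda>j. R0 (length ?u + (Suc (Suc (Suc j)))))"
  have r: "1/3 \<le> r" "r \<le> 3/4"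
    unfolding r_def using cval_bounds[OF seq12_shift[OF seq(1), of "length ?u + 3"]] by (auto simp: numeral_3_eq_3)
  have "s = cf [1,1,2] r"
    unfolding s_def r_def using cval_cf[OF seq12_shift[OF seq(1)] R(3)] by simp
  also have "\<dots> = (3 + r) / (5 + 2 * r)"
    using r by (simp add: field_simps)
  \<comment> \<open>The expression decreases in \<open>r\<close>, and \<open>r = 1/3\<close> gives
    10/17. Later 42/187 = 10/17 - 4/11.\<close>
  also have "\<dots> \<le> 10/17" using r by (simp add: divide_simps)
  finally have s: "s \<le> 10/17" .
  have "4/11 \<le> t" "1/3 \<le> s" unfolding t_def s_def
    using cval_first(2)[OF seq12_shift[OF seq(2)], of "length ?u"] L(3)
      cval_bounds[OF seq12_shift[OF seq(1)], of "length ?u"] by simp_all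
  with s have st: "s - t \<le> 42/187" "0 \<le> s" "0 \<le> t" by auto
  have u: "set ?u \<subseteq> {1,2}" by auto
  have d: "continuant ?u \<le> den ?u s" "continuant ?u \<le> den ?u t" "1 \<le> continuant ?u"
    using den_bounds[OF u] continuant_ge1[OF u] st by auto
  then have d2: "(continuant ?u)\<^sup>2 \<le> den ?u s * den ?u t"
    unfolding power2_eq_square by (intro mult_mono) auto
  have "E0 = (s - t) / (den ?u s * den ?u t)"
    using cval_cf[OF seq(1) R(2)] cval_cf[OF seq(2) L(2)] cf_diff[OF u st(2,3)]
    by (simp add: s_def t_def E0_def)
  also have "\<dots> \<le> (42/187) / (den ?u s * den ?u t)"
    using st d by (intro divide_right_mono) auto
  also have "\<dots> \<le> (42/187) / (continuant ?u)\<^sup>2"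
    using d2 d by (intro divide_left_mono) auto
  finally show "E0 \<le> (42/187) / (continuant ?u)\<^sup>2" .
qed

lemma twos_le_A: "n \<le> 2*k \<Longrightarrow> continuant (twos n) \<le> continuant (wordA k)"
  using continuant_block_mono[of "[]" "[]" n "2*k"]
    continuant_prefix[of "twos (2*k)" "[1,1] @ twos (2*k+2) @ [1,1] @ twos (2*k) @ [1,1] @ twos (2*k+1) @ [1,1] @ twos (2*k+2)"]
  by (auto simp: wordA_def)

text \<open>Here \<open>n < 2k\<close> is the length of the common prefix of two rays at a star; the reference
  rays \<open>R0\<close> and \<open>L0\<close> differ only after \<open>2k\<close> entries.\<close>

lemma E0_margin:
  assumes "n < 2*k"
  shows "E0 + margin \<le> (2/35) / (continuant (twos n))\<^sup>2"
proof -
  let ?K = "continuant (twos (2*k))"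
  have n: "1 \<le> continuant (twos n)" "1 \<le> ?K" by (intro continuant_ge1; auto)+
  have "2 * continuant (twos n) \<le> continuant (twos (Suc n))"
    using continuant_block_ge[of "[]" "[]" n] by simp
  also have "\<dots> \<le> ?K"
    using continuant_block_mono[of "[]" "[]" "Suc n" "2*k"] assms by simp
  finally have "(2 * continuant (twos n))\<^sup>2 \<le> ?K\<^sup>2" using n by (intro power_mono) auto
  then have "(8/35) / ?K\<^sup>2 \<le> (8/35) / (2 * continuant (twos n))\<^sup>2"
    using n by (intro divide_left_mono) auto
  then have "(8/35) / ?K\<^sup>2 \<le> (2/35) / (continuant (twos n))\<^sup>2" by (simp add: power_mult_distrib)
  \<comment> \<open>One more 2 at least doubles the continuant and turns 2/35 into 8/35. What 8/35
    leaves above 42/187 is more than 1/1000.\<close>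
  moreover have "margin \<le> (8/35 - 42/187) / ?K\<^sup>2"
    using twos_le_A[of "2*k"] by (intro margin_le) auto
  ultimately show ?thesis using E0_bounds(2) by (simp add: diff_divide_distrib)
qed

section \<open>Forbidden words\<close>

text \<open>At the last 2 one side contributes at least 7/10 and the other at least 1/3, so the
  value is at least 3 + 1/30. This is too large, because \<open>E0 + margin\<close> is below 1/30
  once \<open>twos (2*k)\<close> has continuant at least 5.\<close>

lemma no_212:
  assumes "low \<theta>" shows "\<not> has \<theta> [2,1,2]"
proof
  assume "has \<theta> [2,1,2]"
  then obtain q where q: "\<theta> q = 2" "\<theta> (q+1) = 1" "\<theta> (q+2) = 2"
    by (auto simp: has_def occ_Cons algebra_simps)
  have th: "\<theta> \<in> words12" using assms by (simp add: low_def)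
  note s = seq12_ray[OF th]
  have "cval (ray \<theta> q (-1)) \<le> 3/7" "1/3 \<le> cval (ray \<theta> q (-1))"
    using cval_first(2)[OF s, of q "-1"] cval_bounds[OF s] q by (auto simp: ray_def)
  moreover have "cval (ray \<theta> (q+1) (-1)) = 1 / (1 + cval (ray \<theta> q (-1)))"
    using cval_rec[OF s, of "q+1" "-1"] q unfolding ray_Suc by (simp add: ray_def)
  ultimately have "7/10 \<le> cval (ray \<theta> (q+1) (-1))" by (simp only:) (simp add: field_simps)
  moreover have "1/3 \<le> cval (ray \<theta> (q+3) 1)" by (rule cval_bounds[OF s])
  moreover have "lambda (q+2) \<theta> = 2 + cval (ray \<theta> (q+3) 1) + cval (ray \<theta> (q+1) (-1))"
    using lambda_rays[OF th, of 1 "q+2"] q by (simp add: algebra_simps)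
  ultimately have "3 + 1/30 \<le> lambda (q+2) \<theta>" by simp
  moreover have "continuant (twos 2) \<le> continuant (twos (2*k))"
    using continuant_block_mono[of "[]" "[]" 2 "2*k"] k by simp
  then have 5: "5 \<le> continuant (twos (2*k))" by (simp add: numeral_2_eq_2 den.simps(2))
  then have "5\<^sup>2 \<le> (continuant (twos (2*k)))\<^sup>2" by (intro power_mono) auto
  then have "(42/187) / (continuant (twos (2*k)))\<^sup>2 \<le> (42/187) / 5\<^sup>2"
    "(1/1000) / (continuant (twos (2*k)))\<^sup>2 \<le> (1/1000) / 5\<^sup>2"
    using 5 by (intro divide_left_mono, auto)+
  moreover have "margin \<le> (1/1000) / (continuant (twos (2*k)))\<^sup>2"
    using twos_le_A[of "2*k"] by (intro margin_le) auto
  moreover have "lambda (q+2) \<theta> < 3 + E0 + margin" using assms by (simp add: low_def)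
  ultimately show False using E0_bounds(2) by simp
qed

text \<open>Take the first 2 of the block of length \<open>m\<close> as the star. After the even
  number \<open>m - 1\<close> of common letters the right ray has a 1 and the left ray a 2, which
  raises the value more than \<open>E0\<close> because \<open>m - 1 < 2*k\<close>.\<close>

lemma no_odd_block:
  assumes "low \<theta>" "odd m" "m \<le> 2*k"
  shows "\<not> has \<theta> (twos (m - 1) @ [1,1] @ twos m @ [1])"
proof
  assume has: "has \<theta> (twos (m - 1) @ [1,1] @ twos m @ [1])"
  obtain n where n: "m = Suc n" "even n" "n < 2*k"
    using assms(2,3) by (cases m) auto
  then have "has \<theta> (twos n @ [1,1,2] @ twos n @ [1])" using has by simp
  from assms(1) this show False
  proof (rule no_star)
    fix R L assume *: "seq12 R" "seq12 L" "starts R (twos n @ [1])" "starts L (2 # rev (twos n))"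
    then have "starts L (twos n @ [2])" by (simp add: word_simps)
    from cval_gap_even[OF *(1,2,3) this] E0_margin[OF n(3)] n(2)
    show "E0 + margin \<le> cval R - cval L" by simp
  qed
qed

text \<open>With the star at the first 2 of the run of length \<open>n + 3\<close>, the left ray
  meets its 1 after \<open>n + 1\<close> letters, counting its artificial leading 2. This number is
  odd, so the left ray is the smaller one.\<close>

lemma no_even_block:
  assumes "low \<theta>" "even n" "n + 1 < 2*k"
  shows "\<not> has \<theta> ([1] @ twos n @ [1,1] @ twos (n + 3))"
proof
  assume "has \<theta> ([1] @ twos n @ [1,1] @ twos (n + 3))"
  then have "has \<theta> (([1] @ twos n) @ [1,1,2] @ twos (n + 2))" by (simp add: numeral_3_eq_3)
  from assms(1) this show False
  proof (rule no_star)
    fix R L assume *: "seq12 R" "seq12 L" "starts R (twos (n + 2))" "starts L (2 # rev ([1] @ twos n))"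
    then have "starts L (twos (Suc n) @ [1])" "starts R (twos (Suc n) @ [2])" by (simp_all add: word_simps)
    from cval_gap_odd[OF *(2,1) this] E0_margin[of "Suc n"] assms(2,3)
    show "E0 + margin \<le> cval R - cval L" by simp
  qed
qed

text \<open>The comparisons for \<open>no_right\<close> and \<open>no_left\<close>: on the left the
  prefix at which one ray deviates, on the right the longer prefix along which the other ray is
  known.\<close>

lemma continuant_blocks:
  shows "96/25 * continuant (twos (2*k) @ [1,1] @ twos (2*k))
      \<le> continuant (twos (2*k+1) @ [1,1] @ twos (2*k+2) @ [1,1] @ twos (2*k))"
    and "96/25 * continuant (twos (2*k+1) @ [1,1] @ twos (2*k))
      \<le> continuant (twos (2*k) @ [1,1] @ twos (2*k+2) @ [1,1] @ twos (2*k))"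
proof -
  define c where "c i j = continuant (twos i @ [1,1] @ twos j)" for i j
  have i: "2 * c i j \<le> c (Suc i) j" "c (Suc i) j \<le> 3 * c i j" for i j
    using continuant_block_ge[of "[]" "[1,1] @ twos j" i] continuant_block_le3[of "[]" "[1,1] @ twos j" i]
    unfolding c_def by auto
  have j: "2 * c i j \<le> c i (Suc j)" for i j
    using continuant_block_ge[of "twos i @ [1,1]" "[]" j] unfolding c_def by auto
  have c: "1 \<le> c i j" for i j unfolding c_def by (intro continuant_ge1) auto
  have s: "12 * c i j \<le> continuant (twos i @ [1,1] @ twos j @ [1,1] @ twos (2*k))" for i j
    using continuant_snoc_block[of "twos i @ [1,1] @ twos j" k] k unfolding c_def by auto
  show "96/25 * continuant (twos (2*k) @ [1,1] @ twos (2*k))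
      \<le> continuant (twos (2*k+1) @ [1,1] @ twos (2*k+2) @ [1,1] @ twos (2*k))"
    using s[of "2*k+1" "2*k+2"] i(1)[of "2*k" "2*k"] j[of "2*k+1" "2*k"] j[of "2*k+1" "2*k+1"] c[of "2*k" "2*k"]
    unfolding c_def[symmetric] by simp
  show "96/25 * continuant (twos (2*k+1) @ [1,1] @ twos (2*k))
      \<le> continuant (twos (2*k) @ [1,1] @ twos (2*k+2) @ [1,1] @ twos (2*k))"
    using s[of "2*k" "2*k+2"] i(2)[of "2*k" "2*k"] j[of "2*k" "2*k"] j[of "2*k" "2*k+1"] c[of "2*k" "2*k"]
    unfolding c_def[symmetric] by simp
qed

text \<open>With the star at the first 2 of the block of length \<open>2*k+1\<close>, the right ray
  has a 1 at an even index where \<open>R0\<close> has a 2. The left ray follows \<open>L0\<close>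
  too long to compensate for this gain.\<close>

lemma no_right:
  assumes "low \<theta>" "even n" "n \<le> 2*k"
  shows "\<not> has \<theta> (twos (2*k) @ [1,1] @ twos (2*k+2) @ [1,1] @ twos (2*k) @ [1,1] @ twos (2*k+1) @ [1,1] @ twos n @ [1])"
proof
  assume "has \<theta> (twos (2*k) @ [1,1] @ twos (2*k+2) @ [1,1] @ twos (2*k) @ [1,1] @ twos (2*k+1) @ [1,1] @ twos n @ [1])"
  then have "has \<theta> ((twos (2*k) @ [1,1] @ twos (2*k+2) @ [1,1] @ twos (2*k)) @ [1,1,2] @ (twos (2*k) @ [1,1] @ twos n @ [1]))"
    by simp
  from assms(1) this show False
  proof (rule no_star)
    fix R L
    let ?u = "twos (2*k) @ [1,1] @ twos n"
    let ?v = "twos (2*k+1) @ [1,1] @ twos (2*k+2) @ [1,1] @ twos (2*k)"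
    assume *: "seq12 R" "seq12 L" "starts R (twos (2*k) @ [1,1] @ twos n @ [1])"
      "starts L (2 # rev (twos (2*k) @ [1,1] @ twos (2*k+2) @ [1,1] @ twos (2*k)))"
    have R: "starts R (?u @ [1])" using *(3) by simp
    have L: "starts L ?v" using *(4) by (simp add: word_simps)
    have B: "wordB k = ?v @ [2] @ [1,1] @ twos (2*k) @ [1,1] @ twos (2*k+2)"
      by (simp add: wordB_def word_simps)
    have L': "starts L0 ?v"
      using L0 unfolding B by (simp only: starts_append)
    have e: "twos (2*k+2) = twos n @ [2] @ twos (2*k+1-n)"
      using assms(3) by (simp add: word_simps flip: replicate_Suc)
    have A: "wordA k = (?u @ [2]) @ twos (2*k+1-n) @ [1,1] @ twos (2*k) @ [1,1] @ twos (2*k+1) @ [1,1] @ twos (2*k+2)"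
      unfolding wordA_def by (subst e) simp
    have R': "starts R0 (?u @ [2])" using R0 unfolding A starts_append by simp
    have u: "set ?u \<subseteq> {1,2}" by auto
    have "continuant ?u \<le> continuant (twos (2*k) @ [1,1] @ twos (2*k))"
      using continuant_block_mono[of "twos (2*k) @ [1,1]" "[]" n "2*k"] assms(3) by auto
    then have "96/25 * continuant ?u \<le> continuant ?v" using continuant_blocks(1) by linarith
    note gap_minus_close[OF continuant_ge1[OF u] this]
    moreover have "margin \<le> (1/40) / (continuant ?u)\<^sup>2"
    proof (intro margin_le disjI1)
      show "continuant ?u \<le> continuant (wordA k)"
        unfolding A by (subst append_assoc, rule continuant_prefix) auto
    qed (use u in auto)
    moreover have "\<bar>cval L - cval L0\<bar> \<le> (5/12) / (continuant ?v)\<^sup>2"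
      by (rule cval_close[OF *(2) seq(2) L L'])
    moreover have "cval R0 + (2/35) / (continuant ?u)\<^sup>2 \<le> cval R"
      using assms(2) by (intro cval_gap_even[OF *(1) seq(1) R R']) auto
    ultimately show "E0 + margin \<le> cval R - cval L" unfolding E0_def by linarith
  qed
qed

text \<open>Mirror situation of \<open>no_right\<close>: the left ray has a 1 at an odd index where
  \<open>L0\<close> has a 2, hence is smaller, while the right ray follows
  \<open>R0\<close>.\<close>

lemma no_left:
  assumes "low \<theta>" "even n" "n \<le> 2*k"
  shows "\<not> has \<theta> ([1] @ twos n @ [1,1] @ twos (2*k) @ [1,1] @ twos (2*k+1) @ [1,1] @ twos (2*k+2) @ [1,1] @ twos (2*k))"
proof
  assume "has \<theta> ([1] @ twos n @ [1,1] @ twos (2*k) @ [1,1] @ twos (2*k+1) @ [1,1] @ twos (2*k+2) @ [1,1] @ twos (2*k))"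
  then have "has \<theta> (([1] @ twos n @ [1,1] @ twos (2*k)) @ [1,1,2] @ (twos (2*k) @ [1,1] @ twos (2*k+2) @ [1,1] @ twos (2*k)))"
    by simp
  from assms(1) this show False
  proof (rule no_star)
    fix R L
    let ?u = "twos (2*k+1) @ [1,1] @ twos n"
    let ?v = "twos (2*k) @ [1,1] @ twos (2*k+2) @ [1,1] @ twos (2*k)"
    assume *: "seq12 R" "seq12 L" "starts R ?v"
      "starts L (2 # rev ([1] @ twos n @ [1,1] @ twos (2*k)))"
    have L: "starts L (?u @ [1])" using *(4) by simp
    have R': "starts R0 ?v"
      using R0 starts_append[of R0 ?v] by (simp add: wordA_def)
    have e: "twos (2*k+2) = twos n @ [2] @ twos (2*k+1-n)"
      using assms(3) by (simp add: word_simps flip: replicate_Suc)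
    have B: "wordB k = (?u @ [2]) @ twos (2*k+1-n) @ [1,1] @ twos (2*k+1) @ [1,1] @ twos (2*k) @ [1,1] @ twos (2*k+2)"
      unfolding wordB_def by (subst e) simp
    have L': "starts L0 (?u @ [2])" using L0 unfolding B starts_append by simp
    have u: "set ?u \<subseteq> {1,2}" by auto
    have "continuant ?u \<le> continuant (twos (2*k+1) @ [1,1] @ twos (2*k))"
      using continuant_block_mono[of "twos (2*k+1) @ [1,1]" "[]" n "2*k"] assms(3) by auto
    then have "96/25 * continuant ?u \<le> continuant ?v" using continuant_blocks(2) by linarith
    note gap_minus_close[OF continuant_ge1[OF u] this]
    moreover have "margin \<le> (1/40) / (continuant ?u)\<^sup>2"
    proof (intro margin_le disjI2)
      show "continuant ?u \<le> continuant (wordB k)"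
        unfolding B by (subst append_assoc, rule continuant_prefix) auto
    qed (use u in auto)
    moreover have "\<bar>cval R - cval R0\<bar> \<le> (5/12) / (continuant ?v)\<^sup>2"
      by (rule cval_close[OF *(1) seq(1) *(3) R'])
    moreover have "cval L + (2/35) / (continuant ?u)\<^sup>2 \<le> cval L0"
      using assms(2) by (intro cval_gap_odd[OF *(2) seq(2) L L']) auto
    ultimately show "E0 + margin \<le> cval R - cval L" unfolding E0_def by linarith
  qed
qed

section \<open>Forced extension\<close>

text \<open>The first of four prices for a deviation. The prefix before it has continuant at most
  that of the whole word, so the price does not depend on where the deviation occurs.\<close>

lemma R_above_even:
  assumes "seq12 R" "starts R (u @ [1])" "wordA k = u @ [2] @ z" "even (length u)"
  shows "cval R0 + (2/35) / (continuant (wordA k))\<^sup>2 \<le> cval R"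
proof -
  have u: "set u \<subseteq> {1,2}" "set ([2] @ z) \<subseteq> {1,2}"
    using wordAB_letters(1)[of k] unfolding assms(3) by auto
  have "starts R0 (u @ [2])" using R0 unfolding assms(3) starts_append by simp
  from cval_gap_even[OF assms(1) seq(1) assms(2) this assms(4)]
  have "cval R0 + (2/35) / (continuant u)\<^sup>2 \<le> cval R" .
  moreover have "1 \<le> continuant u" "continuant u \<le> continuant (wordA k)"
    unfolding assms(3) using continuant_prefix[OF u] continuant_ge1[OF u(1)] by auto
  then have "(2/35) / (continuant (wordA k))\<^sup>2 \<le> (2/35) / (continuant u)\<^sup>2"
    by (intro frac_le power_mono) auto
  ultimately show ?thesis by linarith
qed

text \<open>The reference word is extended by its next letter 1 so that a deviation directly after
  \<open>wordA k\<close> is also covered.\<close>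

lemma R_above_odd:
  assumes "seq12 R" "starts R (u @ [2])" "wordA k @ [1] = u @ [1] @ z" "odd (length u)"
  shows "cval R0 + (2/35) / (continuant (wordA k))\<^sup>2 \<le> cval R"
proof -
  obtain z' where z': "wordA k = u @ z'"
    using assms(3) by (cases z rule: rev_cases) auto
  have u: "set u \<subseteq> {1,2}" "set z' \<subseteq> {1,2}"
    using wordAB_letters(1)[of k] unfolding z' by auto
  have "starts R0 (wordA k @ [1])" using R0 by (simp add: starts_append)
  then have "starts R0 (u @ [1])" unfolding assms(3) starts_append by simp
  from cval_gap_odd[OF seq(1) assms(1) this assms(2,4)]
  have "cval R0 + (2/35) / (continuant u)\<^sup>2 \<le> cval R" .
  moreover have "1 \<le> continuant u" "continuant u \<le> continuant (wordA k)"
    unfolding z' using continuant_prefix[OF u] continuant_ge1[OF u(1)] by auto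
  then have "(2/35) / (continuant (wordA k))\<^sup>2 \<le> (2/35) / (continuant u)\<^sup>2"
    by (intro frac_le power_mono) auto
  ultimately show ?thesis by linarith
qed

text \<open>The left ray enters the value with a minus sign, so here the downward deviations are
  costly and the parities are interchanged.\<close>

lemma L_below_odd:
  assumes "seq12 L" "starts L (u @ [1])" "wordB k = u @ [2] @ z" "odd (length u)"
  shows "cval L + (2/35) / (continuant (wordB k))\<^sup>2 \<le> cval L0"
proof -
  have u: "set u \<subseteq> {1,2}" "set ([2] @ z) \<subseteq> {1,2}"
    using wordAB_letters(2)[of k] unfolding assms(3) by auto
  have "starts L0 (u @ [2])" using L0 unfolding assms(3) starts_append by simp
  from cval_gap_odd[OF assms(1) seq(2) assms(2) this assms(4)]
  have "cval L + (2/35) / (continuant u)\<^sup>2 \<le> cval L0" .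
  moreover have "1 \<le> continuant u" "continuant u \<le> continuant (wordB k)"
    unfolding assms(3) using continuant_prefix[OF u] continuant_ge1[OF u(1)] by auto
  then have "(2/35) / (continuant (wordB k))\<^sup>2 \<le> (2/35) / (continuant u)\<^sup>2"
    by (intro frac_le power_mono) auto
  ultimately show ?thesis by linarith
qed

lemma L_below_even:
  assumes "seq12 L" "starts L (u @ [2])" "wordB k @ [1] = u @ [1] @ z" "even (length u)"
  shows "cval L + (2/35) / (continuant (wordB k))\<^sup>2 \<le> cval L0"
proof -
  obtain z' where z': "wordB k = u @ z'"
    using assms(3) by (cases z rule: rev_cases) auto
  have u: "set u \<subseteq> {1,2}" "set z' \<subseteq> {1,2}"
    using wordAB_letters(2)[of k] unfolding z' by auto
  have "starts L0 (wordB k @ [1])" using L0 by (simp add: starts_append)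
  then have "starts L0 (u @ [1])" unfolding assms(3) starts_append by simp
  from cval_gap_even[OF seq(2) assms(1) this assms(2,4)]
  have "cval L + (2/35) / (continuant u)\<^sup>2 \<le> cval L0" .
  moreover have "1 \<le> continuant u" "continuant u \<le> continuant (wordB k)"
    unfolding z' using continuant_prefix[OF u] continuant_ge1[OF u(1)] by auto
  then have "(2/35) / (continuant (wordB k))\<^sup>2 \<le> (2/35) / (continuant u)\<^sup>2"
    by (intro frac_le power_mono) auto
  ultimately show ?thesis by linarith
qed

lemma no_block_12:
  assumes "low \<theta>" "1 \<le> n"
  shows "\<not> has \<theta> (twos n @ [1,2])"
proof
  assume "has \<theta> (twos n @ [1,2])"
  moreover obtain m where "n = Suc m" using assms(2) by (cases n) auto
  ultimately have "has \<theta> [2,1,2]"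
    by (auto intro: has_factorI[where x = "twos m" and y = "[]"] simp: word_simps)
  then show False using no_212[OF assms(1)] by simp
qed

lemma twos_split: "m < n \<Longrightarrow> twos n = twos m @ [2] @ twos (n - Suc m)"
  by (simp add: word_simps flip: replicate_Suc)

text \<open>At each entry the ray either agrees with \<open>R0\<close>, or completes a forbidden word, or
  deviates upwards, which costs at least \<open>(2/35) / (continuant (wordA k))\<^sup>2\<close>.\<close>

lemma follow_right:
  assumes low: "low \<theta>" and R: "seq12 R"
    and has: "\<And>w. starts R w \<Longrightarrow> has \<theta> (twos (2*k) @ [1,1] @ twos (2*k+2) @ [1,1] @ twos (2*k) @ [1,1,2] @ w)"
    and start: "starts R (twos (2*k) @ [1,1] @ twos (2*k+2) @ [1,1] @ twos (2*k) @ [1])"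
    and not_above: "cval R < cval R0 + (2/35) / (continuant (wordA k))\<^sup>2"
  shows "starts R (wordA k @ [1,1] @ twos (2*k))"
proof -
  let ?P = "twos (2*k) @ [1,1] @ twos (2*k+2) @ [1,1] @ twos (2*k)"
  have has': "has \<theta> f" if "starts R w" "?P @ [1,1,2] @ w = x @ f @ y" for w x f y
    using has_factorI[OF has[OF that(1)]] that(2) by simp
  have ev: False if "starts R (u @ [1])" "wordA k = u @ [2] @ z" "even (length u)" for u z
    using R_above_even[OF R that] not_above by linarith
  have od: False if "starts R (u @ [2])" "wordA k @ [1] = u @ [1] @ z" "odd (length u)" for u z
    using R_above_odd[OF R that] not_above by linarith
  note no12 = no_block_12[OF low, of "2*k"] no_block_12[OF low, of "2*k+1"] no_block_12[OF low, of "2*k+2"] k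
  have s0: "starts R (?P @ [1])" using start by simp
  have s1: "starts R (?P @ [1,1])"
    using starts_digit[OF R s0]
  proof
    assume "starts R ((?P @ [1]) @ [2])"
    then have "has \<theta> (twos (2*k) @ [1,2])"
      by (rule has'[where y = "[]"
            and x = "?P @ [1,1,2] @ twos (2*k) @ [1,1] @ twos (2*k+2) @ [1,1]"]) simp
    then show ?thesis using no12 by simp
  qed simp
  \<comment> \<open>\<open>?P @ [1,1]\<close> has even length: if the run stops early after an even
    number of 2s the ray is raised, after an odd number it is a forbidden odd block.\<close>
  have s2: "starts R ((?P @ [1,1]) @ twos (2*k+1))"
    using starts_run[OF R s1]
  proof
    assume "\<exists>m<2*k+1. starts R ((?P @ [1,1]) @ twos m @ [1])"
    then obtain m where m: "m < 2*k+1" "starts R ((?P @ [1,1]) @ twos m @ [1])" by blast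
    show ?thesis
    proof (cases "even m")
      case True
      have "wordA k = (?P @ [1,1] @ twos m) @ [2] @ twos (2*k - m) @ [1,1] @ twos (2*k+2)"
        unfolding wordA_def using twos_split[OF m(1)] by simp
      then show ?thesis using ev[of "?P @ [1,1] @ twos m"] m(2) True by simp
    next
      case False
      have "has \<theta> (twos (m - 1) @ [1,1] @ twos m @ [1])"
        using m(2) by (rule has'[where y = "[]"
            and x = "?P @ [1,1,2] @ twos (2*k) @ [1,1] @ twos (2*k+2) @ [1,1] @ twos (2*k - (m - 1))"])
          (use m(1) in \<open>simp add: word_simps\<close>)
      then show ?thesis using no_odd_block[OF low False] m(1) by simp
    qed
  qed simp
  have s3: "starts R ((?P @ [1,1] @ twos (2*k+1)) @ [1])"
    using starts_digit[OF R s2]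
  proof
    assume "starts R (((?P @ [1,1]) @ twos (2*k+1)) @ [2])"
    then show ?thesis
      using od[of "?P @ [1,1] @ twos (2*k+1)" "[1] @ twos (2*k+2) @ [1]"] by (simp add: wordA_def)
  qed simp
  have s4: "starts R (?P @ [1,1] @ twos (2*k+1) @ [1,1])"
    using starts_digit[OF R s3]
  proof
    assume "starts R (((?P @ [1,1] @ twos (2*k+1)) @ [1]) @ [2])"
    then have "has \<theta> (twos (2*k+1) @ [1,2])"
      by (rule has'[where y = "[]" and x = "?P @ [1,1,2] @ ?P @ [1,1]"]) simp
    then show ?thesis using no12 by simp
  qed simp
  \<comment> \<open>The block of odd length has switched the parity: odd runs now raise the ray,
    even runs are excluded by \<open>no_right\<close>.\<close>
  have s5: "starts R ((?P @ [1,1] @ twos (2*k+1) @ [1,1]) @ twos (2*k+2))"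
    using starts_run[OF R s4]
  proof
    assume "\<exists>m<2*k+2. starts R ((?P @ [1,1] @ twos (2*k+1) @ [1,1]) @ twos m @ [1])"
    then obtain m where m: "m < 2*k+2" "starts R ((?P @ [1,1] @ twos (2*k+1) @ [1,1]) @ twos m @ [1])"
      by blast
    show ?thesis
    proof (cases "even m")
      case False
      have "wordA k = (?P @ [1,1] @ twos (2*k+1) @ [1,1] @ twos m) @ [2] @ twos (2*k+1 - m)"
        unfolding wordA_def using twos_split[OF m(1)] by simp
      then show ?thesis using ev[of "?P @ [1,1] @ twos (2*k+1) @ [1,1] @ twos m"] m(2) False by simp
    next
      case True
      then have m': "m \<le> 2*k" using m(1) by presburger
      have "has \<theta> (?P @ [1,1] @ twos (2*k+1) @ [1,1] @ twos m @ [1])"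
        using m(2) by (rule has'[where y = "[]" and x = "?P @ [1,1,2]"]) simp
      then show ?thesis using no_right[OF low True m'] by simp
    qed
  qed simp
  then have s5: "starts R (wordA k)" by (simp add: wordA_def)
  have s6: "starts R (wordA k @ [1])"
    using starts_digit[OF R s5]
  proof
    assume "starts R (wordA k @ [2])"
    then show ?thesis
      using od[of "wordA k" "[]"] by (simp add: wordA_def)
  qed
  have s7: "starts R (wordA k @ [1,1])"
    using starts_digit[OF R s6]
  proof
    assume "starts R ((wordA k @ [1]) @ [2])"
    then have "has \<theta> (twos (2*k+2) @ [1,2])"
      by (rule has'[where y = "[]" and x = "?P @ [1,1,2] @ ?P @ [1,1] @ twos (2*k+1) @ [1,1]"])
        (simp add: wordA_def)
    then show ?thesis using no12 by simp
  qed simp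
  \<comment> \<open>This last block lies beyond \<open>wordA k\<close>, where deviations have no
    price. Both parities are excluded by forbidden words alone, using the preceding block of length
    \<open>2*k+2\<close>.\<close>
  from starts_run[OF R s7] have "starts R ((wordA k @ [1,1]) @ twos (2*k))"
  proof
    assume "\<exists>m<2*k. starts R ((wordA k @ [1,1]) @ twos m @ [1])"
    then obtain m where m: "m < 2*k" "starts R ((wordA k @ [1,1]) @ twos m @ [1])" by blast
    show ?thesis
    proof (cases "even m")
      case True
      then have m1: "m + 1 < 2*k" using m(1) by presburger
      have "has \<theta> (rev ([1] @ twos m @ [1,1] @ twos (m + 3)))"
        using m(2) by (rule has'[where y = "[]"
              and x = "?P @ [1,1,2] @ ?P @ [1,1] @ twos (2*k+1) @ [1,1] @ twos (2*k - m - 1)"])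
          (use m1 twos_split[of 0 "2*k"] in \<open>simp add: wordA_def word_simps numeral_3_eq_3\<close>)
      then show ?thesis using no_even_block[OF low True m1] by (simp only: has_rev)
    next
      case False
      have "has \<theta> (twos (m - 1) @ [1,1] @ twos m @ [1])"
        using m(2) by (rule has'[where y = "[]"
              and x = "?P @ [1,1,2] @ ?P @ [1,1] @ twos (2*k+1) @ [1,1] @ twos (2*k+2 - (m - 1))"])
          (use m(1) in \<open>simp add: wordA_def word_simps\<close>)
      then show ?thesis using no_odd_block[OF low False] m(1) by simp
    qed
  qed
  then show ?thesis by simp
qed

text \<open>The same reading for the left ray, with downward deviations as the costly ones. The
  leading 2 of \<open>L\<close> is not a letter of the word, so it is removed and
  \<open>[2,1,1]\<close> put in its place before forbidden words are sought.\<close>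

lemma follow_left:
  assumes low: "low \<theta>" and L: "seq12 L"
    and has: "\<And>w. starts L ([2] @ w) \<Longrightarrow> has \<theta> (twos (2*k) @ [1,1] @ twos (2*k+2) @ [1,1] @ twos (2*k) @ [2,1,1] @ w)"
    and start: "starts L (twos (2*k+1) @ [1,1] @ twos (2*k+2) @ [1,1] @ twos (2*k))"
    and not_below: "cval L0 < cval L + (2/35) / (continuant (wordB k))\<^sup>2"
  shows "starts L (wordB k @ [1,1] @ twos (2*k))"
proof -
  let ?V = "twos (2*k) @ [1,1] @ twos (2*k+2) @ [1,1] @ twos (2*k) @ [2,1,1]"
  let ?U = "twos (2*k+1) @ [1,1] @ twos (2*k+2) @ [1,1]"
  let ?U' = "twos (2*k) @ [1,1] @ twos (2*k+2) @ [1,1]"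
  let ?Q = "?U @ twos (2*k+1)"
  have has': "has \<theta> f" if "starts L w" "w = [2] @ w'" "?V @ w' = x @ f @ y" for w w' x f y
    using has_factorI[OF has[of w']] that by simp
  have ev: False if "starts L (u @ [2])" "wordB k @ [1] = u @ [1] @ z" "even (length u)" for u z
    using L_below_even[OF L that] not_below by linarith
  have od: False if "starts L (u @ [1])" "wordB k = u @ [2] @ z" "odd (length u)" for u z
    using L_below_odd[OF L that] not_below by linarith
  note no12 = no_block_12[OF low, of "2*k"] no_block_12[OF low, of "2*k+1"] no_block_12[OF low, of "2*k+2"] k
  have s0: "starts L (?U @ twos (2*k))" using start by simp
  have s1: "starts L ?Q"
    using starts_digit[OF L s0]
  proof
    assume "starts L ((?U @ twos (2*k)) @ [1])"
    then show ?thesis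
      using od[of "?U @ twos (2*k)" "[1,1] @ twos (2*k) @ [1,1] @ twos (2*k+2)"]
      by (simp add: wordB_def word_simps)
  qed (simp add: word_simps)
  have s2: "starts L (?Q @ [1])"
    using starts_digit[OF L s1]
  proof
    assume "starts L (?Q @ [2])"
    then show ?thesis
      using ev[of ?Q "[1] @ twos (2*k) @ [1,1] @ twos (2*k+2) @ [1]"] by (simp add: wordB_def)
  qed
  have s3: "starts L (?Q @ [1,1])"
    using starts_digit[OF L s2]
  proof
    assume "starts L ((?Q @ [1]) @ [2])"
    then have "has \<theta> (twos (2*k+1) @ [1,2])"
      by (rule has'[where y = "[]" and x = "?V @ ?U'" and w' = "?U' @ twos (2*k+1) @ [1,2]"])
         simp_all
    then show ?thesis using no12 by simp
  qed simp
  \<comment> \<open>\<open>?Q\<close> has even length, so odd runs lower the ray. An even run is at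
    most \<open>2*k - 2\<close>, so the preceding block of length \<open>2*k+1\<close> contains the
    2s that \<open>no_even_block\<close> requires.\<close>
  have s4: "starts L ((?Q @ [1,1]) @ twos (2*k))"
    using starts_run[OF L s3]
  proof
    assume "\<exists>m<2*k. starts L ((?Q @ [1,1]) @ twos m @ [1])"
    then obtain m where m: "m < 2*k" "starts L ((?Q @ [1,1]) @ twos m @ [1])" by blast
    show ?thesis
    proof (cases "even m")
      case False
      have "wordB k = (?Q @ [1,1] @ twos m) @ [2] @ twos (2*k - Suc m) @ [1,1] @ twos (2*k+2)"
        unfolding wordB_def using twos_split[OF m(1)] by simp
      then show ?thesis using od[of "?Q @ [1,1] @ twos m"] m(2) False by simp
    next
      case True
      then have m1: "m + 1 < 2*k" using m(1) by presburger
      have "has \<theta> (rev ([1] @ twos m @ [1,1] @ twos (m + 3)))"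
        using m(2) by (rule has'[where y = "[]" and w' = "?U' @ twos (2*k+1) @ [1,1] @ twos m @ [1]"
              and x = "?V @ ?U' @ twos (2*k - m - 2)"])
          (use m1 twos_split[of 1 "2*k"] in \<open>simp_all add: word_simps numeral_3_eq_3\<close>)
      then show ?thesis using no_even_block[OF low True m1] by (simp only: has_rev)
    qed
  qed simp
  have s5: "starts L ((?Q @ [1,1] @ twos (2*k)) @ [1])"
    using starts_digit[OF L s4]
  proof
    assume "starts L (((?Q @ [1,1]) @ twos (2*k)) @ [2])"
    then show ?thesis
      using ev[of "?Q @ [1,1] @ twos (2*k)" "[1] @ twos (2*k+2) @ [1]"] by (simp add: wordB_def)
  qed simp
  have s6: "starts L (?Q @ [1,1] @ twos (2*k) @ [1,1])"
    using starts_digit[OF L s5]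
  proof
    assume "starts L (((?Q @ [1,1] @ twos (2*k)) @ [1]) @ [2])"
    then have "has \<theta> (twos (2*k) @ [1,2])"
      by (rule has'[where y = "[]" and x = "?V @ ?U' @ twos (2*k+1) @ [1,1]"
            and w' = "?U' @ twos (2*k+1) @ [1,1] @ twos (2*k) @ [1,2]"])
         simp_all
    then show ?thesis using no12 by simp
  qed simp
  have "starts L ((?Q @ [1,1] @ twos (2*k) @ [1,1]) @ twos (2*k+2))"
    using starts_run[OF L s6]
  proof
    assume "\<exists>m<2*k+2. starts L ((?Q @ [1,1] @ twos (2*k) @ [1,1]) @ twos m @ [1])"
    then obtain m where m: "m < 2*k+2" "starts L ((?Q @ [1,1] @ twos (2*k) @ [1,1]) @ twos m @ [1])"
      by blast
    show ?thesis
    proof (cases "even m")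
      case False
      have "wordB k = (?Q @ [1,1] @ twos (2*k) @ [1,1] @ twos m) @ [2] @ twos (2*k+1 - m)"
        unfolding wordB_def using twos_split[OF m(1)] by simp
      then show ?thesis using od[of "?Q @ [1,1] @ twos (2*k) @ [1,1] @ twos m"] m(2) False by simp
    next
      case True
      then have m': "m \<le> 2*k" using m(1) by presburger
      have "has \<theta> (rev ([1] @ twos m @ [1,1] @ twos (2*k) @ [1,1] @ twos (2*k+1) @ [1,1] @ twos (2*k+2) @ [1,1] @ twos (2*k)))"
        using m(2) by (rule has'[where y = "[]" and x = ?V
              and w' = "?U' @ twos (2*k+1) @ [1,1] @ twos (2*k) @ [1,1] @ twos m @ [1]"])
          (simp_all add: word_simps)
      then show ?thesis using no_left[OF low True m'] by (simp only: has_rev)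
    qed
  qed simp
  then have s7: "starts L (wordB k)" by (simp add: wordB_def)
  have s8: "starts L (wordB k @ [1])"
    using starts_digit[OF L s7]
  proof
    assume "starts L (wordB k @ [2])"
    then show ?thesis using ev[of "wordB k" "[]"] by (simp add: wordB_def)
  qed
  have s9: "starts L (wordB k @ [1,1])"
    using starts_digit[OF L s8]
  proof
    assume "starts L ((wordB k @ [1]) @ [2])"
    then have "has \<theta> (twos (2*k+2) @ [1,2])"
      by (rule has'[where y = "[]" and x = "?V @ ?U' @ twos (2*k+1) @ [1,1] @ twos (2*k) @ [1,1]"
            and w' = "?U' @ twos (2*k+1) @ [1,1] @ twos (2*k) @ [1,1] @ twos (2*k+2) @ [1,2]"])
        (simp_all add: wordB_def)
    then show ?thesis using no12 by simp
  qed simp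
  from starts_run[OF L s9] have "starts L ((wordB k @ [1,1]) @ twos (2*k))"
  proof
    assume "\<exists>m<2*k. starts L ((wordB k @ [1,1]) @ twos m @ [1])"
    then obtain m where m: "m < 2*k" "starts L ((wordB k @ [1,1]) @ twos m @ [1])" by blast
    let ?w = "?U' @ twos (2*k+1) @ [1,1] @ twos (2*k) @ [1,1] @ twos (2*k+2) @ [1,1] @ twos m @ [1]"
    show ?thesis
    proof (cases "even m")
      case True
      then have m1: "m + 1 < 2*k" using m(1) by presburger
      have "has \<theta> (rev ([1] @ twos m @ [1,1] @ twos (m + 3)))"
        using m(2) by (rule has'[where y = "[]" and w' = ?w
              and x = "?V @ ?U' @ twos (2*k+1) @ [1,1] @ twos (2*k) @ [1,1] @ twos (2*k - m - 1)"])
          (use m1 twos_split[of 0 "2*k"] in \<open>simp_all add: wordB_def word_simps numeral_3_eq_3\<close>)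
      then show ?thesis using no_even_block[OF low True m1] by (simp only: has_rev)
    next
      case False
      have "has \<theta> (twos (m - 1) @ [1,1] @ twos m @ [1])"
        using m(2) by (rule has'[where y = "[]" and w' = ?w
              and x = "?V @ ?U' @ twos (2*k+1) @ [1,1] @ twos (2*k) @ [1,1] @ twos (2*k+2 - (m - 1))"])
          (use m(1) in \<open>simp_all add: wordB_def word_simps\<close>)
      then show ?thesis using no_odd_block[OF low False] m(1) by simp
    qed
  qed
  then show ?thesis by simp
qed

text \<open>An upward deviation of the right ray cannot be compensated by the left ray, which agrees with
  \<open>L0\<close> along a much longer prefix, and vice versa.\<close>

lemma extend:
  assumes low: "low \<theta>"
    and occ: "occurs_at \<theta> p (twos (2*k) @ [1,1] @ twos (2*k+2) @ [1,1] @ twos (2*k) @ [1,1])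
        ([2] @ twos (2*k) @ [1,1] @ twos (2*k+2) @ [1,1] @ twos (2*k) @ [1])"
  shows "starts (right_ray \<theta> p 1) (wordA k @ [1,1] @ twos (2*k))"
    and "starts (left_ray \<theta> p 1) (wordB k @ [1,1] @ twos (2*k))"
proof -
  let ?U = "twos (2*k) @ [1,1] @ twos (2*k+2) @ [1,1] @ twos (2*k)"
  define R where "R = right_ray \<theta> p 1"
  define L where "L = left_ray \<theta> p 1"
  have th: "\<theta> \<in> words12" using low by (simp add: low_def)
  have seq': "seq12 R" "seq12 L" unfolding R_def L_def using seq12_sides[OF th] by auto
  have occ': "occ \<theta> (p - 6 * int k - 8) (?U @ [1,1,2] @ ?U @ [1])"
    using occ by (simp add: occurs_at_def occ_def algebra_simps)
  then have parts: "occ \<theta> (p - 6 * int k - 8) ?U" "occ \<theta> (p - 2) [1,1,2]" "occ \<theta> (p + 1) (?U @ [1])"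
    unfolding occ_append by (simp_all add: algebra_simps)
  have R: "starts R (?U @ [1])" using parts(3) by (simp only: R_def right_ray_def starts_ray)
  \<comment> \<open>\<open>?U\<close> is a palindrome, so it may be read in either direction; the
    same is used for \<open>hasL\<close>.\<close>
  have "starts (ray \<theta> (p - 3) (-1)) ?U"
    unfolding starts_ray_neg using parts(1) by (simp add: word_simps algebra_simps)
  then have L: "starts L (twos (2*k+1) @ [1,1] @ twos (2*k+2) @ [1,1] @ twos (2*k))"
    by (simp add: L_def)
  have hasR: "has \<theta> (?U @ [1,1,2] @ w)" if "starts R w" for w
  proof -
    have "occ \<theta> (p + 1) w" using that by (simp only: R_def right_ray_def starts_ray)
    then have "occ \<theta> (p - 6 * int k - 8) (?U @ [1,1,2] @ w)"
      using parts(1,2) unfolding occ_append by (simp add: algebra_simps)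
    then show ?thesis unfolding has_def by blast
  qed
  have hasL: "has \<theta> (?U @ [2,1,1] @ w)" if "starts L ([2] @ w)" for w
  proof -
    have "starts (ray \<theta> (p - 3) (-1)) w" using that by (simp add: L_def)
    then have "occ \<theta> (p - 2 - int (length w)) (rev w)"
      unfolding starts_ray_neg by (simp add: algebra_simps)
    then have "occ \<theta> (p - 2 - int (length w)) (rev w @ [1,1,2] @ ?U)"
      using parts(2,3) unfolding occ_append by (simp add: algebra_simps)
    then have "has \<theta> (rev w @ [1,1,2] @ ?U)" unfolding has_def by blast
    then have "has \<theta> (rev (rev w @ [1,1,2] @ ?U))" by (simp only: has_rev)
    then show ?thesis by (simp add: word_simps)
  qed
  have "\<theta> p = 2 \<and> \<theta> (p - 1) = 1 \<and> \<theta> (p - 2 * 1) = 1"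
    using parts(2) by (simp add: occ_Cons)
  then have "lambda p \<theta> = 3 + cval R - cval L"
    unfolding R_def L_def using lambda_star[OF th, of 1 p] by blast
  then have E: "cval R - cval L < cval R0 - cval L0 + margin"
    using low unfolding low_def E0_def by (metis add_diff_eq add_less_cancel_left add.assoc)
  let ?A = "(2/35) / (continuant (wordA k))\<^sup>2" and ?B = "(2/35) / (continuant (wordB k))\<^sup>2"
  have fr: "starts R (wordA k @ [1,1] @ twos (2*k))" if "cval R < cval R0 + ?A"
    by (rule follow_right[OF low seq'(1) hasR[unfolded append_assoc] R[unfolded append_assoc] that])
  have fl: "starts L (wordB k @ [1,1] @ twos (2*k))" if "cval L0 < cval L + ?B"
    by (rule follow_left[OF low seq'(2) hasL[unfolded append_assoc] L that])
  have gA: "margin \<le> ?A - (5/12) / (continuant (wordB k @ [1,1] @ twos (2*k)))\<^sup>2"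
    using gap_minus_close[OF continuant_ge1[OF wordAB_letters(1)] continuant_AB(2)[OF k]]
      margin_le[OF wordAB_letters(1)[of k], of "1/40"] by linarith
  have gB: "margin \<le> ?B - (5/12) / (continuant (wordA k @ [1,1] @ twos (2*k)))\<^sup>2"
    using gap_minus_close[OF continuant_ge1[OF wordAB_letters(2)] continuant_AB(1)[OF k]]
      margin_le[OF wordAB_letters(2)[of k], of "1/40"] by linarith
  have pos: "0 \<le> (5/12) / (continuant w)\<^sup>2" for w by simp
  \<comment> \<open>If \<open>R\<close> deviates it gains \<open>?A\<close>. The left ray then
    either follows \<open>L0\<close> and can offset only the small amount in \<open>gA\<close>, or
    deviates downwards and increases the difference further; both contradict
    \<open>E\<close>.\<close>
  have A: "starts R (wordA k @ [1,1] @ twos (2*k))"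
  proof (rule ccontr)
    assume "\<not> ?thesis"
    then have a: "cval R0 + ?A \<le> cval R" using fr by (auto simp: not_less[symmetric])
    show False
    proof (cases "cval L0 < cval L + ?B")
      case True
      from cval_close[OF seq'(2) seq(2) fl[OF True] L0] show False using a E gA by linarith
    next
      case False
      have "0 \<le> ?B" by simp
      then show False using False a E gA pos[of "wordB k @ [1,1] @ twos (2*k)"] by linarith
    qed
  qed
  then show "starts (right_ray \<theta> p 1) (wordA k @ [1,1] @ twos (2*k))" by (simp only: R_def)
  \<comment> \<open>Now \<open>R\<close> is known along the long word, so its uncertainty plus
    \<open>margin\<close> is less than the price of a deviation of \<open>L\<close>.\<close>
  have "cval L0 < cval L + ?B"
    using cval_close[OF seq'(1) seq(1) A R0] E gB by linarith
  from fl[OF this] show "starts (left_ray \<theta> p 1) (wordB k @ [1,1] @ twos (2*k))" by (simp only: L_def)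
qed

end

section \<open>The value of \<open>gamma1\<close>\<close>

lemma ones2: "ones 2 = [1,1]"
  by (simp add: numeral_2_eq_2)

lemma omega_eq: "omega k = twos (2*k) @ [1,1] @ twos (2*k+1) @ [1,1] @ twos (2*k+2) @ [1,1]"
  unfolding omega_def ones2 by simp

lemma length_omega: "length (omega k) = 6*k+9"
  by (simp add: omega_eq)

lemma omega_nth:
  assumes "r < 6*k+9"
  shows "omega k ! r = (if r \<in> {2*k, 2*k+1, 4*k+3, 4*k+4, 6*k+7, 6*k+8} then 1 else 2)"
proof -
  have "omega k ! r = (if r < 2*k then 2 else if r < 2*k+2 then 1 else if r < 4*k+3 then 2
      else if r < 4*k+5 then 1 else if r < 6*k+7 then 2 else 1)"
    unfolding omega_eq using assms by (auto simp: nth_append nth_Cons' split: if_splits)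
  then show ?thesis using assms by auto
qed

text \<open>The two copies of \<open>omega k\<close> from position 0 on continue the periodic left
  half, so periodicity lasts until twice the period.\<close>

lemma gamma1_periodic:
  assumes "i < 2 * (6 * int k + 9)"
  shows "gamma1 k i = omega k ! nat (i mod (6 * int k + 9))"
proof (cases "i < 0")
  case True
  then show ?thesis by (simp add: gamma1_def biinfinite_def length_omega algebra_simps)
next
  case False
  have l: "int (length (omega k)) = 6 * int k + 9" by (simp add: length_omega)
  show ?thesis
  proof (cases "i < 6 * int k + 9")
    case True
    with False have "i mod (6 * int k + 9) = i" by (intro mod_pos_pos_trivial) auto
    then show ?thesis
      using False True by (simp add: gamma1_def biinfinite_def nth_append length_omega)
  next
    case ge: False
    have "i mod (6 * int k + 9) = (i - (6 * int k + 9)) mod (6 * int k + 9)" by simp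
    also have "\<dots> = i - (6 * int k + 9)"
      using ge assms by (intro mod_pos_pos_trivial) auto
    finally show ?thesis
      using False ge assms by (simp add: gamma1_def biinfinite_def nth_append length_omega nat_diff_distrib nat_less_iff nat_add_distrib nat_mult_distrib)
  qed
qed

lemma gamma1_tail: "2 * (6 * int k + 9) \<le> i \<Longrightarrow> gamma1 k i = 2"
  by (simp add: gamma1_def biinfinite_def length_omega)

lemma gamma1_at:
  assumes "c \<le> 1" "r < 6*k+9"
  shows "gamma1 k (c * (6 * int k + 9) + int r) = omega k ! r"
proof -
  define N where "N = 6 * int k + 9"
  have r: "int r < N" using assms(2) by (simp add: N_def)
  define M where "M = c * N"
  have "M \<le> 1 * N"
    unfolding M_def using assms(1) by (intro mult_right_mono) (simp_all add: N_def)
  then have "M + int r < 2 * N" using r by simp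
  then have "c * N + int r < 2 * N" by (simp only: M_def)
  moreover have "(c * N + int r) mod N = int r"
    using r by (simp add: mod_pos_pos_trivial)
  ultimately show ?thesis
    using gamma1_periodic[of "c * N + int r" k] by (simp add: N_def)
qed

lemma gamma1_words12: "gamma1 k \<in> words12"
proof -
  have "gamma1 k i = 1 \<or> gamma1 k i = 2" for i
  proof (cases "i < 2 * (6 * int k + 9)")
    case True
    have "nat (i mod (6 * int k + 9)) < 6*k+9"
      using pos_mod_bound[of "6 * int k + 9" i] by linarith
    from omega_nth[OF this] show ?thesis using gamma1_periodic[OF True] by simp
  qed (use gamma1_tail[of k i] in simp)
  then show ?thesis by (auto simp: words12_def)
qed

lemma occ_omega:
  assumes "c \<le> 1"
  shows "occ (gamma1 k) (c * (6 * int k + 9)) (omega k)"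
  unfolding occ_def length_omega using gamma1_at[OF assms] by simp

lemma occ_omega2:
  assumes "c \<le> 0"
  shows "occ (gamma1 k) (c * (6 * int k + 9)) (omega k @ omega k)"
  using occ_omega[of c k] occ_omega[of "c + 1" k] assms
  by (simp add: occ_append length_omega algebra_simps)

lemma occ_omega3:
  assumes "c \<le> -1"
  shows "occ (gamma1 k) (c * (6 * int k + 9)) (omega k @ omega k @ omega k)"
  using occ_omega[of c k] occ_omega2[of "c + 1" k] assms
  by (simp add: occ_append length_omega algebra_simps)

lemma occ_tail: "2 * (6 * int k + 9) \<le> q \<Longrightarrow> occ (gamma1 k) q (twos m)"
  by (simp add: occ_def gamma1_tail)

lemma occ_omega_tail: "occ (gamma1 k) (6 * int k + 9) (omega k @ twos m)"
  using occ_omega[of 1 k] occ_tail[of k "2 * (6 * int k + 9)" m]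
  by (simp add: occ_append length_omega algebra_simps)

lemma occ_omega2_tail: "occ (gamma1 k) 0 (omega k @ omega k @ twos m)"
  using occ_omega[of 0 k] occ_omega_tail[of k m]
  by (simp add: occ_append length_omega algebra_simps)

lemma occ_part: "occ \<theta> q w \<Longrightarrow> w = x @ f @ y \<Longrightarrow> q' = q + int (length x) \<Longrightarrow> occ \<theta> q' f"
  by (simp add: occ_append)

section \<open>Bounds for the entries of \<open>gamma1\<close>\<close>

lemma lambda_le_one:
  assumes "\<theta> \<in> words12" "\<theta> i = 1"
  shows "lambda i \<theta> \<le> 3"
  using lambda_rays[OF assms(1), of 1 i] assms(2)
    cval_bounds(2)[OF seq12_ray[OF assms(1)], of "i + 1" 1]
    cval_bounds(2)[OF seq12_ray[OF assms(1)], of "i - 1" "-1"] by simp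

lemma lambda_le_inner:
  assumes "\<theta> \<in> words12" "\<theta> i = 2" "\<theta> (i - 1) = 2" "\<theta> (i + 1) = 2"
  shows "lambda i \<theta> \<le> 3"
proof -
  note s = seq12_ray[OF assms(1)]
  have "cval (ray \<theta> (i + 1) 1) \<le> 3/7" "cval (ray \<theta> (i - 1) (-1)) \<le> 3/7"
    using cval_first(2)[OF s, of "i+1" 1] cval_first(2)[OF s, of "i-1" "-1"] assms(3,4)
    by (auto simp: ray_def)
  then show ?thesis using lambda_rays[OF assms(1), of 1 i] assms(2) by simp
qed

lemma lambda_le_3:
  assumes "\<theta> \<in> words12" "d = 1 \<or> d = -1" "\<theta> p = 2" "\<theta> (p - d) = 1" "\<theta> (p - 2 * d) = 1"
    and "starts (right_ray \<theta> p d) (twos n @ [1])" "starts (left_ray \<theta> p d) (twos n @ [2])" "odd n"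
  shows "lambda p \<theta> \<le> 3"
proof -
  have "cval (right_ray \<theta> p d) + (2/35) / (continuant (twos n))\<^sup>2 \<le> cval (left_ray \<theta> p d)"
    by (rule cval_gap_odd[OF seq12_sides[OF assms(1)] assms(6,7)]) (simp add: assms(8))
  moreover have "0 \<le> (2/35) / (continuant (twos n))\<^sup>2" by simp
  ultimately show ?thesis
    using lambda_star[OF assms(1-5)] by linarith
qed

text \<open>The star at \<open>2*k+2\<close> is the first entry of the block of length
  \<open>2*k+1\<close> in the copy of \<open>omega k\<close> starting at position 0; one more copy
  follows before the 2s begin.\<close>

lemma threshold_gamma1:
  assumes "1 \<le> k"
  shows "threshold k (right_ray (gamma1 k) (2 * int k + 2) 1) (left_ray (gamma1 k) (2 * int k + 2) 1)"
proof
  show "1 \<le> k" by fact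
  show "seq12 (right_ray (gamma1 k) (2 * int k + 2) 1)" "seq12 (left_ray (gamma1 k) (2 * int k + 2) 1)"
    using seq12_sides[OF gamma1_words12] by auto
  show "starts (right_ray (gamma1 k) (2 * int k + 2) 1) (wordA k @ [1,1] @ twos (2*k))"
    unfolding right_ray_def starts_ray
    by (rule occ_part[OF occ_omega2_tail[of k "2*k"], of "twos (2*k) @ [1,1,2]" _ "[]"])
      (simp_all add: omega_eq wordA_def word_simps)
  have "occ (gamma1 k) ((-2) * (6 * int k + 9)) (omega k @ omega k @ omega k)" by (rule occ_omega3) simp
  then have "occ (gamma1 k) (- 15 - 10 * int k)
      (twos (2*k) @ [1,1] @ twos (2*k+2) @ [1,1] @ omega k @ twos (2*k))"
    by (rule occ_part[where x = "twos (2*k) @ [1,1,2]" and y = "[1,1] @ twos (2*k+1) @ [1,1] @ twos (2*k+2) @ [1,1]"])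
      (simp_all add: omega_eq word_simps)
  then have "starts (ray (gamma1 k) (2 * int k + 2 - 3 * 1) (-1))
      (twos (2*k) @ [1,1] @ twos (2*k+2) @ [1,1] @ twos (2*k+1) @ [1,1] @ twos (2*k) @ [1,1] @ twos (2*k+2) @ [1,1] @ twos (2*k))"
    unfolding starts_ray_neg by (simp add: omega_eq word_simps algebra_simps)
  then show "starts (left_ray (gamma1 k) (2 * int k + 2) 1) (wordB k @ [1,1] @ twos (2*k))"
    by (simp add: wordB_def)
qed

text \<open>To the left of such an entry only the periodic part is visible, so corresponding entries
  of different copies can differ only in their right rays.\<close>

lemma left_ray_gamma1_periodic:
  assumes "c \<le> 1"
  shows "left_ray (gamma1 k) (c * (6 * int k + 9) + 2 * int k + 2) 1 = left_ray (gamma1 k) (2 * int k + 2) 1"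
proof -
  define N where "N = 6 * int k + 9"
  define M where "M = c * N"
  have "M \<le> 1 * N"
    unfolding M_def using assms by (intro mult_right_mono) (simp_all add: N_def)
  then have M: "M \<le> N" by simp
  have "gamma1 k (M + 2 * int k + 2 - 3 * 1 + - 1 * int j) = gamma1 k (2 * int k + 2 - 3 * 1 + - 1 * int j)" for j
  proof -
    define x where "x = 2 * int k - 1 - int j"
    have x: "x < N" by (simp add: x_def N_def)
    have "(M + x) mod N = x mod N" by (simp add: M_def)
    moreover have "M + x < 2 * N" "x < 2 * N" using x M by (simp_all add: N_def)
    ultimately have "gamma1 k (M + x) = gamma1 k x"
      using gamma1_periodic[of "M + x" k] gamma1_periodic[of x k] by (simp only: N_def)
    then show ?thesis by (simp add: x_def algebra_simps)
  qed
  then show ?thesis unfolding left_ray_def ray_def M_def N_def by (auto split: nat.split)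
qed

text \<open>Identifies where the supremum is attained. Only the first and last 2 of a block can have
  a value above 3; these are compared with the star according to their residue modulo the
  period.\<close>

lemma lambda_gamma1_le:
  assumes k: "1 \<le> k"
  shows "lambda i (gamma1 k) \<le> lambda (2 * int k + 2) (gamma1 k)"
proof -
  let ?g = "gamma1 k"
  define N where "N = 6 * int k + 9"
  let ?Rg = "right_ray ?g (2 * int k + 2) 1" and ?Lg = "left_ray ?g (2 * int k + 2) 1"
  interpret threshold k ?Rg ?Lg by (rule threshold_gamma1[OF k])
  note g = gamma1_words12[of k]
  note sR = seq12_sides(1)[OF g] and sL = seq12_sides(2)[OF g]
  let ?K = "continuant (twos (2*k))"
  have K: "1 \<le> ?K" by (intro continuant_ge1) auto
  have "occ ?g 0 (omega k @ omega k)" by (rule occ_omega2[of 0 k, simplified])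
  then have "occ ?g (2 * int k) [1,1,2]"
    by (rule occ_part[where x = "twos (2*k)" and y = "twos (2*k) @ [1,1] @ twos (2*k+2) @ [1,1] @ omega k"])
      (simp_all add: omega_eq word_simps)
  then have l0: "lambda (2 * int k + 2) ?g = 3 + E0"
    unfolding E0_def using lambda_star[OF g, of 1 "2 * int k + 2"] by (simp add: occ_Cons algebra_simps)
  have E0pos: "0 \<le> E0" using E0_bounds(1) by (rule order.trans[rotated]) simp
  have le3: "lambda i ?g \<le> lambda (2 * int k + 2) ?g" if "lambda i ?g \<le> 3" for i
    using that l0 E0pos by linarith
  \<comment> \<open>A common prefix with continuant at least \<open>4 * ?K\<close> bounds the
    difference of the rays by (5/12)/16 over \<open>?K\<close> squared, less than the 2/35
    guaranteed for \<open>E0\<close>.\<close>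
  have close: "lambda p ?g \<le> lambda (2 * int k + 2) ?g"
    if "d = 1 \<or> d = -1" "?g p = 2" "?g (p - d) = 1" "?g (p - 2 * d) = 1"
      "starts (right_ray ?g p d) u" "starts (left_ray ?g p d) u" "4 * ?K \<le> continuant u" for p d u
  proof -
    have "(4 * ?K)\<^sup>2 \<le> (continuant u)\<^sup>2" using that(7) K by (intro power_mono) auto
    then have "(5/12) / (continuant u)\<^sup>2 \<le> (5/12) / (4 * ?K)\<^sup>2"
      using K that(7) by (intro divide_left_mono) auto
    also have "\<dots> \<le> (2/35) / ?K\<^sup>2" using K by (simp add: power_mult_distrib divide_simps)
    finally show ?thesis
      using cval_close[OF sR sL that(5,6)] lambda_star[OF g that(1-4)] l0 E0_bounds(1) by linarith
  qed
  have periodic: "lambda (c * N + int r) ?g \<le> lambda (2 * int k + 2) ?g" if c: "c \<le> 1" and r: "r < 6*k+9" for c r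
  proof -
    define q where "q = c * N"
    have at: "?g (q + int s) = (if s \<in> {2*k, 2*k+1, 4*k+3, 4*k+4, 6*k+7, 6*k+8} then 1 else 2)"
      if "s < 6*k+9" for s
      using gamma1_at[OF c that] omega_nth[OF that] by (simp add: q_def N_def)
    have "occ ?g ((c - 1) * (6 * int k + 9)) (omega k @ omega k)" by (rule occ_omega2) (use c in simp)
    then have occ2: "occ ?g (q - N) (omega k @ omega k)" by (simp add: q_def N_def algebra_simps)
    then have occ1: "occ ?g q (omega k)" by (simp add: occ_append length_omega N_def)
    obtain m where m: "2*k = Suc m" using k by (cases "2*k") auto
    then have mo: "odd m" and mi: "2 * int k = 1 + int m" by presburger+
    consider "r \<in> {2*k, 2*k+1, 4*k+3, 4*k+4, 6*k+7, 6*k+8}" | "r = 0" | "r = 2*k-1" | "r = 2*k+2" | "r = 4*k+2"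
      | "r = 4*k+5" | "r = 6*k+6"
      | "r \<notin> {0, 2*k-1, 2*k+2, 4*k+2, 4*k+5, 6*k+6, 2*k, 2*k+1, 4*k+3, 4*k+4, 6*k+7, 6*k+8}" by blast
    then have "lambda (q + int r) ?g \<le> lambda (2 * int k + 2) ?g"
    proof cases
      case 1
      then have "?g (q + int r) = 1" using at[OF r] by simp
      then show ?thesis using lambda_le_one[OF g] le3 by blast
    next
      case 8
      have "?g (q + int r) = 2" using at[OF r] 8 by simp
      moreover have "?g (q + int (r + 1)) = 2"
      proof -
        have "r \<noteq> 6*k+8" using 8 by simp
        then have "r + 1 < 6*k+9" using r by linarith
        from at[OF this] show ?thesis using 8 by auto
      qed
      moreover have "?g (q + int (r - 1)) = 2"
      proof -
        obtain s where s: "r = Suc s" using 8 by (cases r) auto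
        then have "s < 6*k+9" using r by auto
        from at[OF this] show ?thesis using 8 r s by auto
      qed
      moreover have "q + int (r - 1) = q + int r - 1" "q + int (r + 1) = q + int r + 1" using 8 by auto
      ultimately have "lambda (q + int r) ?g \<le> 3" using lambda_le_inner[OF g] by metis
      then show ?thesis by (rule le3)
    next
      case 2
      have "occ ?g (q + 1) (twos m @ [1])"
        by (rule occ_part[OF occ1, where x = "[2]" and y = "[1] @ twos (2*k+1) @ [1,1] @ twos (2*k+2) @ [1,1]"])
          (simp_all add: omega_eq word_simps m)
      then have R: "starts (right_ray ?g q 1) (twos m @ [1])" by (simp only: right_ray_def starts_ray)
      have "occ ?g (q - int m - 2) (twos m)"
        by (rule occ_part[OF occ2, where x = "twos (2*k) @ [1,1] @ twos (2*k+1) @ [1,1] @ [2,2,2]" and y = "[1,1] @ omega k"])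
          (use mi in \<open>simp_all add: omega_eq word_simps m N_def\<close>)
      then have L: "starts (left_ray ?g q 1) (twos m @ [2])"
        by (simp add: word_simps starts_ray_neg algebra_simps)
      have "occ ?g (q - 2) [1,1,2]"
        by (rule occ_part[OF occ2, where x = "twos (2*k) @ [1,1] @ twos (2*k+1) @ [1,1] @ twos (2*k+2)"
              and y = "twos m @ [1,1] @ twos (2*k+1) @ [1,1] @ twos (2*k+2) @ [1,1]"])
          (use mi in \<open>simp_all add: omega_eq word_simps m N_def\<close>)
      then have "?g q = 2 \<and> ?g (q - 1) = 1 \<and> ?g (q - 2 * 1) = 1" by (simp add: occ_Cons)
      then have "lambda q ?g \<le> 3" using lambda_le_3[OF g _ _ _ _ R L mo] by simp
      then show ?thesis using 2 le3 by simp
    next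
      case 3
      have p: "q + int r = q + int m" using 3 m by simp
      have "occ ?g (q - 1) ([1] @ twos m)"
        by (rule occ_part[OF occ2, where x = "twos (2*k) @ [1,1] @ twos (2*k+1) @ [1,1] @ twos (2*k+2) @ [1]"
              and y = "[2] @ [1,1] @ twos (2*k+1) @ [1,1] @ twos (2*k+2) @ [1,1]"])
          (use mi in \<open>simp_all add: omega_eq word_simps m N_def\<close>)
      then have R: "starts (right_ray ?g (q + int m) (-1)) (twos m @ [1])"
        unfolding right_ray_def starts_ray_neg by (simp add: word_simps)
      have "occ ?g (q + int m + 3) (twos m)"
        by (rule occ_part[OF occ1, where x = "twos (2*k) @ [1,1]" and y = "[2,2,1,1] @ twos (2*k+2) @ [1,1]"])
          (simp_all add: omega_eq word_simps m)
      then have L: "starts (left_ray ?g (q + int m) (-1)) (twos m @ [2])"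
        by (simp add: word_simps starts_ray)
      have "?g (q + int m) = 2 \<and> ?g (q + int m - -1) = 1 \<and> ?g (q + int m - 2 * -1) = 1"
      proof -
        have e: "q + int m = q + int (2*k-1)" "q + int m - -1 = q + int (2*k)" "q + int m - 2 * -1 = q + int (2*k+1)"
          using m by auto
        have "2*k-1 < 6*k+9" "2*k-1 \<notin> {2*k, 2*k+1, 4*k+3, 4*k+4, 6*k+7, 6*k+8}" using k by auto
        then show ?thesis unfolding e(2,3) unfolding e(1) using at[of "2*k-1"] at[of "2*k"] at[of "2*k+1"] by simp
      qed
      then have "lambda (q + int m) ?g \<le> 3" using lambda_le_3[OF g _ _ _ _ R L mo] by simp
      then show ?thesis unfolding p by (rule le3)
    next
      \<comment> \<open>The copies of the star. The left rays coincide; for \<open>c = 1\<close> the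
        right ray meets the infinite run of 2s earlier, at an even index, and for
        \<open>c <= -1\<close> it has a 1 at an odd index where the reference has a 2. Both make it
        smaller.\<close>
      case 4
      let ?u = "twos (2*k) @ [1,1] @ twos (2*k+2) @ [1,1] @ twos (2*k)"
      let ?R = "right_ray ?g (q + 2 * int k + 2) 1"
      have "occ ?g (q + 2 * int k) [1,1,2]"
        by (rule occ_part[OF occ1, where x = "twos (2*k)" and y = "twos (2*k) @ [1,1] @ twos (2*k+2) @ [1,1]"])
          (simp_all add: omega_eq word_simps)
      then have "lambda (q + 2 * int k + 2) ?g = 3 + cval ?R - cval ?Lg"
        using lambda_star[OF g, of 1 "q + 2 * int k + 2"] left_ray_gamma1_periodic[OF c, of k]
        by (simp add: occ_Cons q_def N_def algebra_simps)
      moreover consider "c = 0" | "c = 1" | "c \<le> -1" using c by linarith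
      then have "cval ?R \<le> cval ?Rg"
      proof cases
        case 1
        then show ?thesis by (simp add: q_def)
      next
        case 2
        have "occ ?g (q + 2 * int k + 3) (?u @ [2])"
          by (rule occ_part[OF occ_omega_tail[of k "2*k+1"], where x = "twos (2*k) @ [1,1,2]" and y = "[]"])
            (simp_all add: omega_eq word_simps q_def N_def 2)
        then have R: "starts ?R (?u @ [2])" by (simp add: right_ray_def starts_ray algebra_simps)
        have A: "wordA k = (?u @ [1]) @ [1] @ twos (2*k+1) @ [1,1] @ twos (2*k+2)"
          by (simp add: wordA_def)
        have "starts ?Rg (?u @ [1])"
          using R0 unfolding A starts_append[of _ "?u @ [1]"] append_assoc[of "?u @ [1]"] by blast
        from cval_gap_even[OF sR sR this R]
        have "cval ?R + (2/35) / (continuant ?u)\<^sup>2 \<le> cval ?Rg" by simp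
        moreover have "0 \<le> (2/35) / (continuant ?u)\<^sup>2" by simp
        ultimately show ?thesis by linarith
      next
        case 3
        let ?v = "wordA k @ [1,1] @ twos (2*k)"
        have "occ ?g q (omega k @ omega k @ omega k)" unfolding q_def N_def by (rule occ_omega3[OF 3])
        then have "occ ?g (q + 2 * int k + 3) (?v @ [1])"
          by (rule occ_part[where x = "twos (2*k) @ [1,1,2]" and y = "[1] @ twos (2*k+1) @ [1,1] @ twos (2*k+2) @ [1,1]"])
            (simp_all add: omega_eq wordA_def word_simps)
        then have "starts ?R (?v @ [1])" by (simp add: right_ray_def starts_ray algebra_simps)
        moreover have "occ ?g (2 * int k + 3) (?v @ [2])"
          by (rule occ_part[OF occ_omega2_tail[of k "2*k+1"], where x = "twos (2*k) @ [1,1,2]" and y = "[]"])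
            (simp_all add: omega_eq wordA_def word_simps)
        then have "starts ?Rg (?v @ [2])" by (simp add: right_ray_def starts_ray algebra_simps)
        ultimately have "cval ?R + (2/35) / (continuant ?v)\<^sup>2 \<le> cval ?Rg"
          by (intro cval_gap_odd[OF sR sR]) (auto simp: wordA_def)
        moreover have "0 \<le> (2/35) / (continuant ?v)\<^sup>2" by simp
        ultimately show ?thesis by linarith
      qed
      ultimately have "lambda (q + 2 * int k + 2) ?g \<le> 3 + E0" unfolding E0_def by linarith
      moreover have "q + int r = q + 2 * int k + 2" using 4 by simp
      ultimately show ?thesis using l0 by (simp only:)
    next
      \<comment> \<open>Last 2 of the block of length \<open>2*k+1\<close>, read backwards. The left
        ray runs through the neighbouring longer block and exceeds the reference by a gap at prefix
        \<open>twos (2*k+1)\<close>, while the right ray stays close to its reference.\<close>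
      case 5
      let ?p = "q + 4 * int k + 2" and ?u = "twos (2*k) @ [1,1] @ twos (2*k)"
      have "occ ?g q ?u"
        by (rule occ_part[OF occ1, where x = "[]" and y = "[2] @ [1,1] @ twos (2*k+2) @ [1,1]"])
          (simp_all add: omega_eq word_simps)
      then have R: "starts (right_ray ?g ?p (-1)) ?u"
        unfolding right_ray_def starts_ray_neg by (simp add: algebra_simps)
      have A: "wordA k = ?u @ [2,2,1,1] @ twos (2*k) @ [1,1] @ twos (2*k+1) @ [1,1] @ twos (2*k+2)"
        by (simp add: wordA_def word_simps)
      have R': "starts ?Rg ?u"
        using R0 unfolding A starts_append[of _ ?u] append_assoc[of ?u] by blast
      have "occ ?g (q + 4 * int k + 5) (twos (2*k+1))"
        by (rule occ_part[OF occ1, where x = "twos (2*k) @ [1,1] @ twos (2*k+1) @ [1,1]" and y = "[2] @ [1,1]"])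
          (simp_all add: omega_eq word_simps)
      then have "starts (ray ?g (?p - 3 * (-1)) (- (-1))) (twos (2*k+1))"
        by (simp only: flip: starts_ray) (simp add: algebra_simps)
      then have L: "starts (left_ray ?g ?p (-1)) (twos (2*k+1) @ [2])"
        by (simp add: word_simps)
      have B: "wordB k = (twos (2*k+1) @ [1]) @ [1] @ twos (2*k+2) @ [1,1] @ twos (2*k+1) @ [1,1] @ twos (2*k) @ [1,1] @ twos (2*k+2)"
        by (simp add: wordB_def)
      have L': "starts ?Lg (twos (2*k+1) @ [1])"
        using L0 unfolding B starts_append[of _ "twos (2*k+1) @ [1]"] append_assoc[of "twos (2*k+1) @ [1]"] by blast
      have "cval ?Lg + (2/35) / (continuant (twos (2*k+1)))\<^sup>2 \<le> cval (left_ray ?g ?p (-1))"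
        by (rule cval_gap_odd[OF sL sL L' L]) simp
      moreover note cval_close[OF sR sR R R']
      moreover have "96/25 * continuant (twos (2*k+1)) \<le> continuant ?u"
        using continuant_snoc_block[of "twos (2*k)" k] continuant_block_le3[of "[]" "[]" "2*k"] k K by simp
      then have "(1/40) / (continuant (twos (2*k+1)))\<^sup>2
          \<le> (2/35) / (continuant (twos (2*k+1)))\<^sup>2 - (5/12) / (continuant ?u)\<^sup>2"
        by (intro gap_minus_close continuant_ge1) auto
      moreover have "0 \<le> (1/40) / (continuant (twos (2*k+1)))\<^sup>2" by simp
      moreover have "?g ?p = 2 \<and> ?g (?p - -1) = 1 \<and> ?g (?p - 2 * -1) = 1"
        using at[of "4*k+2"] at[of "4*k+3"] at[of "4*k+4"] by (simp add: algebra_simps)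
      then have "lambda ?p ?g = 3 + cval (right_ray ?g ?p (-1)) - cval (left_ray ?g ?p (-1))"
        using lambda_star[OF g, of "-1" ?p] by blast
      ultimately have "lambda ?p ?g \<le> 3 + E0" unfolding E0_def by linarith
      then show ?thesis using 5 l0 by (simp add: algebra_simps)
    next
      case 6
      let ?p = "q + 4 * int k + 5"
      have "occ ?g (q + 4 * int k + 6) (twos (2*k+1) @ [1])"
        by (rule occ_part[OF occ1, where x = "twos (2*k) @ [1,1] @ twos (2*k+1) @ [1,1,2]" and y = "[1]"])
          (simp_all add: omega_eq word_simps)
      then have R: "starts (right_ray ?g ?p 1) (twos (2*k+1) @ [1])"
        unfolding right_ray_def starts_ray by (simp add: algebra_simps)
      have "occ ?g (q + 2 * int k + 2) (twos (2*k+1))"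
        by (rule occ_part[OF occ1, where x = "twos (2*k) @ [1,1]" and y = "[1,1] @ twos (2*k+2) @ [1,1]"])
          (simp_all add: omega_eq word_simps)
      then have "starts (ray ?g (?p - 3 * 1) (- 1)) (twos (2*k+1))"
        unfolding starts_ray_neg by (simp add: word_simps algebra_simps)
      then have L: "starts (left_ray ?g ?p 1) (twos (2*k+1) @ [2])"
        by (simp add: word_simps)
      have "?g ?p = 2 \<and> ?g (?p - 1) = 1 \<and> ?g (?p - 2 * 1) = 1"
        using at[of "4*k+5"] at[of "4*k+4"] at[of "4*k+3"] by (simp add: algebra_simps)
      then have "lambda ?p ?g \<le> 3" using lambda_le_3[OF g _ _ _ _ R L] by simp
      then show ?thesis using 6 le3 by (simp add: algebra_simps)
    next
      \<comment> \<open>Last 2 of the block of length \<open>2*k+2\<close>. For \<open>c = 1\<close>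
        the infinite run of 2s follows and the value is at most 3; otherwise the two rays share
        \<open>twos (2*k+1) @ [1,1]\<close> and \<open>close\<close> applies.\<close>
      case 7
      let ?p = "q + 6 * int k + 6"
      have "occ ?g (q + 4 * int k + 3) ([1,1] @ twos (2*k+1))"
        by (rule occ_part[OF occ1, where x = "twos (2*k) @ [1,1] @ twos (2*k+1)" and y = "[2,1,1]"])
          (simp_all add: omega_eq word_simps)
      then have R: "starts (right_ray ?g ?p (-1)) (twos (2*k+1) @ [1,1])"
        unfolding right_ray_def starts_ray_neg by (simp add: word_simps algebra_simps)
      have star: "?g ?p = 2" "?g (?p - -1) = 1" "?g (?p - 2 * -1) = 1"
        using at[of "6*k+6"] at[of "6*k+7"] at[of "6*k+8"] by (simp_all add: algebra_simps)
      have "lambda ?p ?g \<le> lambda (2 * int k + 2) ?g"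
      proof (cases "c = 1")
        case True
        have "occ ?g (q + N) (twos (2*k+1))"
          by (rule occ_tail) (simp add: True q_def N_def)
        then have "starts (ray ?g (?p - 3 * (-1)) (- (-1))) (twos (2*k+1))"
          by (simp only: flip: starts_ray) (simp add: N_def algebra_simps)
        then have L: "starts (left_ray ?g ?p (-1)) (twos (2*k+1) @ [2])"
          by (simp add: word_simps)
        have R': "starts (right_ray ?g ?p (-1)) (twos (2*k+1) @ [1])"
          using R starts_append[of _ "twos (2*k+1) @ [1]" "[1]"] by simp
        have "lambda ?p ?g \<le> 3" using lambda_le_3[OF g _ star R' L] by simp
        then show ?thesis by (rule le3)
      next
        case False
        have "occ ?g ((c + 1) * (6 * int k + 9)) (omega k)" by (rule occ_omega) (use False c in simp)
        then have "occ ?g (q + N) (twos (2*k) @ [1,1])"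
          by (rule occ_part[where x = "[]" and y = "twos (2*k+1) @ [1,1] @ twos (2*k+2) @ [1,1]"])
            (simp_all add: omega_eq q_def N_def algebra_simps)
        then have L: "starts (left_ray ?g ?p (-1)) (twos (2*k+1) @ [1,1])"
          by (simp add: word_simps starts_ray N_def algebra_simps)
        have "4 * ?K \<le> continuant (twos (2*k+1) @ [1,1])"
          using continuant_append[of "twos (2*k+1)" "[1,1]"] continuant_block_ge[of "[]" "[]" "2*k"]
          by (simp add: den.simps(2))
        then show ?thesis by (intro close[OF _ star R L]) auto
      qed
      then show ?thesis using 7 by (simp add: algebra_simps)
    qed
    then show ?thesis by (simp only: q_def)
  qed
  show ?thesis
  proof (cases "i < 2 * N")
    case True
    have N: "0 < N" by (simp add: N_def)
    have i: "i div N * N + i mod N = i" by simp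
    have r: "0 \<le> i mod N" "i mod N < N" using N by auto
    have "i div N \<le> 1"
    proof (rule ccontr)
      assume "\<not> i div N \<le> 1"
      then have "2 * N \<le> i div N * N" using N by (intro mult_right_mono) auto
      then show False using i r True by linarith
    qed
    moreover have "nat (i mod N) < 6*k+9" using \<open>i mod N < N\<close> by (simp add: N_def nat_less_iff)
    ultimately show ?thesis using periodic[of "i div N" "nat (i mod N)"] i r by simp
  next
    case False
    show ?thesis
    \<comment> \<open>The first 2 of the infinite run is the one entry left that is adjacent to a 1;
      its rays share \<open>twos (2*k+2)\<close>.\<close>
    proof (cases "i = 2 * N")
      case True
      have "occ ?g (2 * N + 1) (twos (2*k+2))" by (rule occ_tail) (simp add: N_def)
      then have R: "starts (right_ray ?g (2 * N) 1) (twos (2*k+2))"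
        by (simp only: right_ray_def starts_ray)
      have o: "occ ?g N (omega k)" using occ_omega[of 1 k] by (simp add: N_def)
      have "occ ?g (N + 4 * int k + 6) (twos (2*k+1) @ [1,1])"
        by (rule occ_part[OF o, where x = "twos (2*k) @ [1,1] @ twos (2*k+1) @ [1,1,2]" and y = "[]"])
          (simp_all add: omega_eq word_simps)
      then have o': "occ ?g (N + 4 * int k + 6) (twos (2*k+1))" "occ ?g (N + 6 * int k + 7) [1,1]"
        unfolding occ_append by (simp_all add: algebra_simps)
      have "starts (ray ?g (2 * N - 3 * 1) (- 1)) (twos (2*k+1))"
        unfolding starts_ray_neg using o'(1) by (simp add: word_simps N_def algebra_simps)
      then have L: "starts (left_ray ?g (2 * N) 1) (twos (2*k+2))" by simp
      have star: "?g (2 * N) = 2" "?g (2 * N - 1) = 1" "?g (2 * N - 2 * 1) = 1"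
        using o'(2) gamma1_tail[of k "2 * N"] by (simp_all add: occ_Cons N_def algebra_simps)
      have "4 * ?K \<le> continuant (twos (2*k+2))"
        using continuant_block_ge[of "[]" "[]" "2*k"] continuant_block_ge[of "[]" "[]" "2*k+1"] by simp
      then show ?thesis unfolding True by (intro close[OF _ star R L]) auto
    next
      case ne: False
      have "lambda i ?g \<le> 3"
        using False ne by (intro lambda_le_inner[OF g]) (auto intro!: gamma1_tail simp: N_def)
      then show ?thesis by (rule le3)
    qed
  qed
qed

section \<open>Choice of the constant and the periodic left half\<close>

lemma occurs_at_occ: "occurs_at \<theta> p u v \<longleftrightarrow> occ \<theta> (p - int (length u)) (u @ v)"
  by (simp only: occurs_at_def occ_def)

theorem lemma3p15:
  fixes k :: nat
  assumes "k \<ge> 1"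
  shows "\<exists>l. l > markov (gamma1 k) \<and>
    (\<forall>\<theta>. admissible k l \<theta> \<and>
      occurs_at \<theta> 0
        (twos (2*k) @ ones 2 @ twos (2*k+2) @ ones 2 @ twos (2*k) @ ones 2)
        ([2] @ twos (2*k) @ ones 2 @ twos (2*k+2) @ ones 2 @ twos (2*k) @ [1])
      \<longrightarrow>
      occurs_at \<theta> 0
        (twos (2*k) @ ones 2 @ twos (2*k+2) @ ones 2 @ twos (2*k) @ ones 2 @
         twos (2*k+1) @ ones 2 @ twos (2*k+2) @ ones 2 @ twos (2*k) @ ones 2)
        ([2] @ twos (2*k) @ ones 2 @ twos (2*k+2) @ ones 2 @ twos (2*k) @ ones 2 @
         twos (2*k+1) @ ones 2 @ twos (2*k+2) @ ones 2 @ twos (2*k)) \<and>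
      occurs_at \<theta> (- (6 * int k + 9))
        (twos (2*k) @ ones 2 @ twos (2*k+2) @ ones 2 @ twos (2*k) @ ones 2)
        ([2] @ twos (2*k) @ ones 2 @ twos (2*k+2) @ ones 2 @ twos (2*k) @ [1]) \<and>
      occurs_left_periodic \<theta> 0
        (twos (2*k) @ ones 2 @ twos (2*k+1) @ ones 2 @ twos (2*k+2) @ ones 2)
        (twos (2*k) @ ones 2)
        ([2] @ twos (2*k) @ ones 2 @ twos (2*k+2) @ ones 2 @ twos (2*k) @ ones 2 @
         twos (2*k+1) @ ones 2 @ twos (2*k+2) @ ones 2 @ twos (2*k)))"
proof -
  let ?Rg = "right_ray (gamma1 k) (2 * int k + 2) 1" and ?Lg = "left_ray (gamma1 k) (2 * int k + 2) 1"
  interpret threshold k ?Rg ?Lg by (rule threshold_gamma1[OF assms])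
  \<comment> \<open>\<open>3 + E0\<close> is the value of \<open>gamma1 k\<close> at its star, which
    bounds all its values.\<close>
  define l where "l = 3 + E0 + margin"
  let ?A = "twos (2*k) @ [1,1] @ twos (2*k+2) @ [1,1] @ twos (2*k) @ [1,1]"
  let ?B = "[2] @ twos (2*k) @ [1,1] @ twos (2*k+2) @ [1,1] @ twos (2*k) @ [1]"
  let ?U = "twos (2*k) @ [1,1] @ twos (2*k+2) @ [1,1] @ twos (2*k) @ [1,1] @
         twos (2*k+1) @ [1,1] @ twos (2*k+2) @ [1,1] @ twos (2*k) @ [1,1]"
  let ?V = "[2] @ twos (2*k) @ [1,1] @ twos (2*k+2) @ [1,1] @ twos (2*k) @ [1,1] @
         twos (2*k+1) @ [1,1] @ twos (2*k+2) @ [1,1] @ twos (2*k)"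
  have "lambda i (gamma1 k) \<le> 3 + E0" for i
  proof -
    have "occ (gamma1 k) (2 * int k) [1,1,2]"
      by (rule occ_part[OF occ_omega[of 0 k], where x = "twos (2*k)" and y = "twos (2*k) @ [1,1] @ twos (2*k+2) @ [1,1]"])
        (simp_all add: omega_eq word_simps)
    then have "lambda (2 * int k + 2) (gamma1 k) = 3 + E0"
      unfolding E0_def using lambda_star[OF gamma1_words12[of k], of 1 "2 * int k + 2"]
      by (simp add: occ_Cons algebra_simps)
    then show ?thesis using lambda_gamma1_le[OF assms, of i] by simp
  qed
  then have "markov (gamma1 k) \<le> 3 + E0"
    unfolding markov_def by (intro cSUP_least) auto
  then have l: "markov (gamma1 k) < l" using margin_pos by (simp add: l_def)

  have step: "occurs_at \<theta> p ?U ?V \<and> occurs_at \<theta> (p - (6 * int k + 9)) ?A ?B"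
    if low: "low \<theta>" and occ: "occurs_at \<theta> p ?A ?B" for \<theta> p
  proof -
    have "starts (ray \<theta> (p + 1) 1) (wordA k @ [1,1] @ twos (2*k))"
      using extend(1)[OF low occ] by (simp only: right_ray_def)
    then have R: "occ \<theta> (p + 1) (wordA k @ [1,1] @ twos (2*k))" by (simp only: starts_ray)
    have "starts (ray \<theta> (p - 3) (-1)) (twos (2*k) @ [1,1] @ twos (2*k+2) @ [1,1] @ twos (2*k+1) @ [1,1]
        @ twos (2*k) @ [1,1] @ twos (2*k+2) @ [1,1] @ twos (2*k))"
      using extend(2)[OF low occ] by (simp add: wordB_def)
    then have L: "occ \<theta> (p - 12 * int k - 17) (twos (2*k) @ [1,1] @ twos (2*k+2) @ [1,1] @ twos (2*k) @ [1,1]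
        @ twos (2*k+1) @ [1,1] @ twos (2*k+2) @ [1,1] @ twos (2*k))"
      unfolding starts_ray_neg by (simp add: word_simps algebra_simps)
    have "occ \<theta> (p - 2) [1,1,2]"
      using occ unfolding occurs_at_occ
      by (rule occ_part[where x = "twos (2*k) @ [1,1] @ twos (2*k+2) @ [1,1] @ twos (2*k)"
            and y = "twos (2*k) @ [1,1] @ twos (2*k+2) @ [1,1] @ twos (2*k) @ [1]"]) simp_all
    with L have "occ \<theta> (p - 12 * int k - 17) ((twos (2*k) @ [1,1] @ twos (2*k+2) @ [1,1] @ twos (2*k) @ [1,1]
        @ twos (2*k+1) @ [1,1] @ twos (2*k+2) @ [1,1] @ twos (2*k)) @ [1,1,2])"
      unfolding occ_append[of _ _ _ "[1,1,2]"] by (simp add: algebra_simps)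
    with R have "occ \<theta> (p - 12 * int k - 17) (((twos (2*k) @ [1,1] @ twos (2*k+2) @ [1,1] @ twos (2*k) @ [1,1]
        @ twos (2*k+1) @ [1,1] @ twos (2*k+2) @ [1,1] @ twos (2*k)) @ [1,1,2]) @ (wordA k @ [1,1] @ twos (2*k)))"
      unfolding occ_append[of _ _ _ "wordA k @ [1,1] @ twos (2*k)"] by (simp add: algebra_simps)
    then have UV: "occ \<theta> (p - 12 * int k - 17) (?U @ ?V)"
      by (simp add: wordA_def)
    then have "occurs_at \<theta> p ?U ?V" by (simp add: occurs_at_occ algebra_simps)
    \<comment> \<open>\<open>?U\<close> is exactly \<open>?A @ ?B\<close> followed by one more 1, so
      the extended word contains the initial string again, one period to the left.\<close>
    moreover have "occ \<theta> (p - 12 * int k - 17) (?A @ ?B)"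
      using UV by (rule occ_part[where x = "[]" and y = "[1] @ ?V"]) (simp_all add: word_simps)
    then have "occurs_at \<theta> (p - (6 * int k + 9)) ?A ?B" by (simp add: occurs_at_occ algebra_simps)
    ultimately show ?thesis by blast
  qed

  have concl: "occurs_at \<theta> 0 ?U ?V \<and> occurs_at \<theta> (- (6 * int k + 9)) ?A ?B \<and>
      occurs_left_periodic \<theta> 0 (omega k) (twos (2*k) @ [1,1]) ?V"
    if adm: "admissible k l \<theta>" and occ: "occurs_at \<theta> 0 ?A ?B" for \<theta>
  proof -
    have th: "\<theta> \<in> words12" using adm by (simp add: admissible_def)
    \<comment> \<open>The real supremum is an upper bound only for a bounded family; 2 + 3/4 + 3/4
      is below 4.\<close>
    have "lambda i \<theta> \<le> 4" for i
    proof -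
      have "range \<theta> \<subseteq> {1,2}" using th by (simp add: words12_def)
      then have "\<theta> i \<in> {1,2}" by (rule subsetD) (rule rangeI)
      then have "\<theta> i \<le> 2" by auto
      then show ?thesis
        using lambda_rays[OF th, of 1 i] cval_bounds(2)[OF seq12_ray[OF th], of "i + 1" 1]
          cval_bounds(2)[OF seq12_ray[OF th], of "i - 1" "-1"] by simp
    qed
    then have "bdd_above (range (\<lambda>i. lambda i \<theta>))" by (auto simp: bdd_above_def)
    then have "lambda i \<theta> \<le> markov \<theta>" for i
      unfolding markov_def by (rule cSUP_upper[OF UNIV_I])
    then have low: "low \<theta>"
      using adm th unfolding admissible_def low_def l_def by (metis le_less_trans)
    define N where "N = 6 * int k + 9"
    have all: "occurs_at \<theta> (- (int n * N)) ?A ?B" for n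
    proof (induction n)
      case (Suc n)
      have "- (int (Suc n) * N) = - (int n * N) - (6 * int k + 9)" by (simp add: N_def algebra_simps)
      then show ?case using step[OF low Suc] by simp
    qed (use occ in simp)
    have "\<theta> (i - (2 * int k + 2)) = omega k ! nat (i mod N)" if "i < 0" for i
    proof -
      have N: "0 < N" by (simp add: N_def)
      \<comment> \<open>Position \<open>i\<close> lies in the copy number \<open>n + 1\<close> to
        the left, that is \<open>i div N = - n - 1\<close>; the string at \<open>- (n * N)\<close>
        determines this copy.\<close>
      define n where "n = nat (- (i div N) - 1)"
      have "i div N < 0" using that N by (simp add: pos_imp_zdiv_neg_iff)
      then have "i div N = - int n - 1" by (simp add: n_def)
      then have "(- int n - 1) * N + i mod N = i" using div_mult_mod_eq[of i N] by (simp only:)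
      then have n: "i = - (int n * N) - N + i mod N" by (simp add: algebra_simps)
      have "occurs_at \<theta> (- (int n * N)) ?U ?V" using step[OF low all] by blast
      then have o: "occ \<theta> (- (int n * N) - 12 * int k - 17) (?U @ ?V)"
        by (simp add: occurs_at_occ algebra_simps)
      have "occ \<theta> (- (int n * N) - N - (2 * int k + 2)) (omega k)"
        using o by (rule occ_part[where x = "twos (2*k) @ [1,1] @ twos (2*k+2) @ [1,1]"
              and y = "twos (2*k) @ [1,1] @ ?V"]) (simp_all add: omega_eq N_def)
      moreover have "nat (i mod N) < 6*k+9" "0 \<le> i mod N"
        using pos_mod_bound[OF N, of i] pos_mod_sign[OF N, of i] by (auto simp: N_def nat_less_iff)
      ultimately have "\<theta> (- (int n * N) - N - (2 * int k + 2) + i mod N) = omega k ! nat (i mod N)"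
        unfolding occ_def length_omega by (metis int_nat_eq)
      moreover have "- (int n * N) - N - (2 * int k + 2) + i mod N = i - (2 * int k + 2)" using n by linarith
      ultimately show ?thesis by (simp only:)
    qed
    moreover have UV: "occ \<theta> (- 17 - 12 * int k) (?U @ ?V)"
      using step[OF low occ] by (simp add: occurs_at_occ algebra_simps)
    then have "occ \<theta> (- 2 - 2 * int k) (twos (2*k) @ [1,1] @ ?V)"
      by (rule occ_part[where x = "twos (2*k) @ [1,1] @ twos (2*k+2) @ [1,1] @ twos (2*k) @ [1,1] @
         twos (2*k+1) @ [1,1] @ twos (2*k+2) @ [1,1]" and y = "[]"]) simp_all
    then have "occurs_at \<theta> 0 (twos (2*k) @ [1,1]) ?V"
      by (simp add: occurs_at_occ algebra_simps)
    ultimately have "occurs_left_periodic \<theta> 0 (omega k) (twos (2*k) @ [1,1]) ?V"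
      unfolding occurs_left_periodic_def by (simp add: length_omega N_def algebra_simps)
    then show ?thesis using step[OF low occ] by simp
  qed
  show ?thesis
    unfolding ones2 using l concl[unfolded omega_eq] by blast
qed

end
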